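(* Suppose Assumptions 1 and 2 hold. Let $\mathbf X^\star=\mathbf U^\star(\boldsymbol\Lambda^\star)^{1/2}\in\mathbb R^{n\times d}$ and $\hat{\mathbf X}=\mathbf U\boldsymbol\Lambda^{1/2}$ (the $d$-dimensional adjacency spectral embedding of $\mathbf R$). Then, with high probability, $$\min_{\mathbf Q\in\mathbb O_d}\big\|\hat{\mathbf X}-\mathbf X^\star\mathbf Q\big\|_{2,\infty}\le C\sqrt{\frac{d\log T}{\gamma\lambda^\star_d}}\left[1+\kappa\left(\kappa\sqrt{\frac{\log n}{\gamma}}+\sqrt{\frac1T}\right)\|\mathbf R^\star\|_{2,\infty}\right].$$
   Context: Setup. Let $n,T$ be positive integers and $\mathbf Z^\star\in\mathbb R^{n\times T}$ a deterministic real matrix whose $i$-th row $\mathbf Z^\star_i\in\mathbb R^T$ is the $i$-th (true) time series. The observed data are $\mathbf Z=\mathbf Z^\star+\mathbf N$, where $\mathbf N\in\mathbb R^{n\times T}$ is random noise with rows $\mathbf N_1,\dots,\mathbf N_n$. Let $\mathbf M=\mathbf I-\frac1T\mathbf J\in\mathbb R^{T\times T}$ be the centering projection ($\mathbf J$ the all-ones matrix). Define the signal powers $\sigma^{\star2}_i=\frac1T\|\mathbf M\mathbf Z^\star_i\|^2=\frac1T\sum_{t=1}^T(Z^\star_{i,t}-\frac1T\sum_{s}Z^\star_{i,s})^2$, assumed positive for all $i$, and their noisy versions $\hat\sigma_i^2=\frac1T\|\mathbf M\mathbf Z_i\|^2$. Let $\boldsymbol\Sigma^\star=\operatorname{diag}(\sigma^{\star2}_1,\dots,\sigma^{\star2}_n)$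 and $\hat{\boldsymbol\Sigma}=\operatorname{diag}(\hat\sigma^2_1,\dots,\hat\sigma^2_n)$. The true and observed correlation matrices are $\mathbf R^\star=\frac1T(\boldsymbol\Sigma^\star)^{-1/2}\mathbf Z^\star\mathbf M\mathbf Z^{\star\top}(\boldsymbol\Sigma^\star)^{-1/2}$ and $\mathbf R=\frac1T\hat{\boldsymbol\Sigma}^{-1/2}\mathbf Z\mathbf M\mathbf Z^{\top}\hat{\boldsymbol\Sigma}^{-1/2}$. $\mathbf R^\star$ is positive semidefinite; let $d=\operatorname{rank}\mathbf R^\star$, with nonzero eigenvalues $\lambda^\star_1\ge\dots\ge\lambda^\star_d>0$, $\boldsymbol\Lambda^\star=\operatorname{diag}(\lambda^\star_1,\dots,\lambda^\star_d)$, and $\mathbf U^\star\in\mathbb R^{n\times d}$ with orthonormal columns such that $\mathbf R^\star=\mathbf U^\star\boldsymbol\Lambda^\star\mathbf U^{\star\top}$. Let $\kappa=\lambda^\star_1/\lambda^\star_d$. Let $\boldsymbol\Lambda=\operatorname{diag}(\hat\lambda_1,\dots,\hat\lambda_d)$ contain the $d$ largest eigenvalues of $\mathbf R$ and $\mathbf U\in\mathbb R^{n\times d}$ corresponding orthonormal eigenvectors. Assumption 1: the rows $\mathbf N_1,\dots,\mathbf N_n$ are mean zero and independent, $n=O(T)$, and each $\mathbf N_i$ is a $\nu_i$-subgaussian random vector (for every fixed unit vector $\mathbf u\in\mathbb R^T$, $\mathbf u^\top\mathbf N_i$ is $\nu_i$-subgaussian). Define $\gamma=\min_{i\in[n]}\sigma^{\star2}_i/\nu_i$.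 Assumption 2: $\lambda^\star_d$ is bounded away from zero ($\lambda^\star_d=\Omega(1)$), $\kappa=o(T)$, and $\kappa\log T/\gamma=o(1)$. Conventions: asymptotics are as $n,T\to\infty$; $C$ denotes a positive constant not depending on $n,T$; "with high probability" means with probability tending to one; $O_P,o_P$ are the usual stochastic order symbols. $\|\cdot\|$ is the spectral norm (Euclidean norm for vectors), $\|\cdot\|_F$ the Frobenius norm, $\|\mathbf B\|_{2,\infty}$ the maximum Euclidean norm of the rows of $\mathbf B$, and $\mathbb O_d$ the set of $d\times d$ orthogonal matrices. *)

theory Defs
  imports "HOL-Probability.Probability" "HOL-Library.Landau_Symbols"
begin

text \<open>Matrices of varying size are represented as functions nat => nat => real,
  only the entries with indices in the stated ranges being meaningful.
  Row i of an n x T data matrix Z is (\<lambda>t. Z i t).\<close>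

definition row_mean :: "nat \<Rightarrow> (nat \<Rightarrow> nat \<Rightarrow> real) \<Rightarrow> nat \<Rightarrow> real" where
  "row_mean T Z i = (1 / real T) * (\<Sum>s<T. Z i s)"

definition sig2 :: "nat \<Rightarrow> (nat \<Rightarrow> nat \<Rightarrow> real) \<Rightarrow> nat \<Rightarrow> real" where
  "sig2 T Z i = (1 / real T) * (\<Sum>t<T. (Z i t - row_mean T Z i)\<^sup>2)"

text \<open>(1/T) Z M Z^T, entry (i,j) (M is symmetric idempotent)\<close>
definition cgram :: "nat \<Rightarrow> (nat \<Rightarrow> nat \<Rightarrow> real) \<Rightarrow> nat \<Rightarrow> nat \<Rightarrow> real" where
  "cgram T Z i j = (1 / real T) * (\<Sum>t<T. (Z i t - row_mean T Z i) * (Z j t - row_mean T Z j))"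

definition corr :: "nat \<Rightarrow> (nat \<Rightarrow> nat \<Rightarrow> real) \<Rightarrow> nat \<Rightarrow> nat \<Rightarrow> real" where
  "corr T Z i j = cgram T Z i j / (sqrt (sig2 T Z i) * sqrt (sig2 T Z j))"

definition orthonormal_cols :: "nat \<Rightarrow> nat \<Rightarrow> (nat \<Rightarrow> nat \<Rightarrow> real) \<Rightarrow> bool" where
  "orthonormal_cols m p U \<longleftrightarrow>
     (\<forall>a<p. \<forall>b<p. (\<Sum>i<m. U i a * U i b) = (if a = b then 1 else 0))"

definition orth_mats :: "nat \<Rightarrow> (nat \<Rightarrow> nat \<Rightarrow> real) set" where
  "orth_mats d = {Q. orthonormal_cols d d Q \<and> (\<forall>a b. (a \<ge> d \<or> b \<ge> d) \<longrightarrow> Q a b = 0)}"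

definition top_eigenpairs ::
  "nat \<Rightarrow> nat \<Rightarrow> (nat \<Rightarrow> nat \<Rightarrow> real) \<Rightarrow> (nat \<Rightarrow> nat \<Rightarrow> real) \<Rightarrow> (nat \<Rightarrow> real) \<Rightarrow> bool" where
  "top_eigenpairs n d A U lam \<longleftrightarrow>
     orthonormal_cols n d U \<and>
     (\<forall>a<d. \<forall>i<n. (\<Sum>j<n. A i j * U j a) = lam a * U i a) \<and>
     (\<forall>a b. a \<le> b \<longrightarrow> b < d \<longrightarrow> lam b \<le> lam a) \<and>
     (\<forall>v \<mu>. (\<exists>i<n. v i \<noteq> 0) \<longrightarrow> (\<forall>i<n. (\<Sum>j<n. A i j * v j) = \<mu> * v i) \<longrightarrow>
            (\<forall>a<d. (\<Sum>i<n. v i * U i a) = 0) \<longrightarrow> \<mu> \<le> lam (d - 1))"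

definition norm_2inf :: "nat \<Rightarrow> nat \<Rightarrow> (nat \<Rightarrow> nat \<Rightarrow> real) \<Rightarrow> real" where
  "norm_2inf m p B = Max ((\<lambda>i. sqrt (\<Sum>a<p. (B i a)\<^sup>2)) ` {..<m})"

definition embed :: "(nat \<Rightarrow> nat \<Rightarrow> real) \<Rightarrow> (nat \<Rightarrow> real) \<Rightarrow> nat \<Rightarrow> nat \<Rightarrow> real" where
  "embed U lam i a = U i a * sqrt (lam a)"

definition matmul :: "nat \<Rightarrow> (nat \<Rightarrow> nat \<Rightarrow> real) \<Rightarrow> (nat \<Rightarrow> nat \<Rightarrow> real) \<Rightarrow> nat \<Rightarrow> nat \<Rightarrow> real" where
  "matmul p A B i j = (\<Sum>c<p. A i c * B c j)"

definition subgaussian :: "'a measure \<Rightarrow> ('a \<Rightarrow> real) \<Rightarrow> real \<Rightarrow> bool" where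
  "subgaussian M X \<nu> \<longleftrightarrow> X \<in> borel_measurable M \<and>
     (\<forall>l::real. integrable M (\<lambda>\<omega>. exp (l * X \<omega>)) \<and>
                (\<integral>\<omega>. exp (l * X \<omega>) \<partial>M) \<le> exp (l\<^sup>2 * \<nu> / 2))"

end

theory Submission
  imports Defs
begin

text \<open>
  Let \<open>Y\<close> and \<open>W\<close> be the centred signal and noise rows, divided by \<open>sqrt T\<close> times the true standard
  deviation, so that \<open>Y\<close> has unit rows, \<open>R\<^sup>* = Y Y\<^sup>T\<close>, and \<open>R = Yh Yh\<^sup>T\<close> for \<open>Yh = D (Y + W)\<close> with
  \<open>D\<close> the diagonal matrix that renormalises the rows. With right singular vectors \<open>V\<close>, \<open>Vh\<close> (as columns) the
  embeddings are \<open>X = Y V\<close> and \<open>Xh = Yh Vh\<close>. For \<open>H = V\<^sup>T Vh\<close>, its polar factor \<open>Q\<close> and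
  \<open>G = (I - V V\<^sup>T) Vh\<close>, the error splits into
  \<open>Xh - X Q = D W V H + D W G + D X (H - Q) + (D - I) X Q\<close>.
  Because \<open>I - V V\<^sup>T\<close> annihilates the rows of \<open>Y\<close>, \<open>G\<close> is the image of \<open>W\<^sup>T D Uh\<close>
  scaled by the inverse singular values of \<open>Yh\<close>; hence \<open>|G| \<le> 4 w / sqrt \<lambda>\<^sub>d\<close> with \<open>w = |W|\<close>, and
  \<open>|H - Q| \<le> |G|\<^sup>2\<close>. All terms but the first (and the part of \<open>D - I\<close> linear in \<open>W V\<close>) are therefore
  quadratic in \<open>w\<close>, and only two random quantities matter: the row norms of \<open>W V\<close>, of order
  \<open>sqrt (d log n / (\<gamma> T))\<close>, and \<open>w\<close>, of order \<open>1 / sqrt \<gamma>\<close> by a net argument. The quadratic terms are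
  absorbed by the second summand of the bound since \<open>\<parallel>R\<^sup>*\<parallel>\<close> in the 2-to-infinity norm is at least
  \<open>sqrt \<lambda>\<^sub>d\<close>.
\<close>

section \<open>Finite-dimensional vectors as functions\<close>

definition ip :: "nat \<Rightarrow> (nat \<Rightarrow> real) \<Rightarrow> (nat \<Rightarrow> real) \<Rightarrow> real" where
  "ip m x y = (\<Sum>i<m. x i * y i)"

definition nrm :: "nat \<Rightarrow> (nat \<Rightarrow> real) \<Rightarrow> real" where
  "nrm m x = sqrt (\<Sum>i<m. (x i)\<^sup>2)"

text \<open>The vectors are \<open>X a\<close>, so for the matrix with rows \<open>X a\<close> this
  is its transpose applied to \<open>c\<close>. Spectral norms appear as bounds on
  \<open>nrm m (lincomb k c X)\<close>.\<close>

definition lincomb :: "nat \<Rightarrow> (nat \<Rightarrow> real) \<Rightarrow> (nat \<Rightarrow> nat \<Rightarrow> real) \<Rightarrow> nat \<Rightarrow> real" where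
  "lincomb k c X t = (\<Sum>a<k. c a * X a t)"

text \<open>The vectors are the rows \<open>X a\<close>, whereas \<open>orthonormal_cols\<close>
  speaks of columns.\<close>

definition orthonormal_sys :: "nat \<Rightarrow> nat \<Rightarrow> (nat \<Rightarrow> nat \<Rightarrow> real) \<Rightarrow> bool" where
  "orthonormal_sys m k X \<longleftrightarrow> (\<forall>a<k. \<forall>b<k. ip m (X a) (X b) = (if a = b then 1 else 0))"

lemma ip_commute: "ip m x y = ip m y x"
  by (simp add: ip_def mult.commute)

lemma ip_add_left: "ip m (\<lambda>t. x t + y t) z = ip m x z + ip m y z"
  by (simp add: ip_def distrib_right sum.distrib)

lemma ip_add_right: "ip m z (\<lambda>t. x t + y t) = ip m z x + ip m z y"
  by (simp add: ip_def distrib_left sum.distrib)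

lemma ip_diff_left: "ip m (\<lambda>t. x t - y t) z = ip m x z - ip m y z"
  by (simp add: ip_def left_diff_distrib sum_subtractf)

lemma ip_diff_right: "ip m z (\<lambda>t. x t - y t) = ip m z x - ip m z y"
  by (simp add: ip_def right_diff_distrib sum_subtractf)

lemma ip_scale_left: "ip m (\<lambda>t. c * x t) z = c * ip m x z"
  by (simp add: ip_def sum_distrib_left mult.assoc)

lemma ip_scale_right: "ip m z (\<lambda>t. c * x t) = c * ip m z x"
  by (simp add: ip_def sum_distrib_left mult_ac)

lemma ip_cong: "(\<And>i. i < m \<Longrightarrow> x i = x' i) \<Longrightarrow> (\<And>i. i < m \<Longrightarrow> y i = y' i) \<Longrightarrow> ip m x y = ip m x' y'"
  by (auto simp: ip_def intro!: sum.cong)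

lemma ip_lincomb_left: "ip m (lincomb k c X) y = (\<Sum>a<k. c a * ip m (X a) y)"
  unfolding ip_def lincomb_def sum_distrib_right sum_distrib_left
  by (subst sum.swap) (simp add: mult.assoc)

lemma ip_lincomb_right: "ip m y (lincomb k c X) = (\<Sum>a<k. c a * ip m y (X a))"
  using ip_lincomb_left[of m k c X y] by (simp add: ip_commute)

lemma ip_self: "ip m x x = (nrm m x)\<^sup>2"
  by (simp add: ip_def nrm_def power2_eq_square sum_nonneg)

lemma nrm_sq: "(nrm m x)\<^sup>2 = (\<Sum>i<m. (x i)\<^sup>2)"
  by (simp add: nrm_def sum_nonneg)

lemma nrm_nonneg [simp]: "0 \<le> nrm m x"
  by (simp add: nrm_def sum_nonneg)

lemma nrm_L2_set: "nrm m x = L2_set x {..<m}"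
  by (simp add: nrm_def L2_set_def)

lemma nrm_cong: "(\<And>i. i < m \<Longrightarrow> x i = y i) \<Longrightarrow> nrm m x = nrm m y"
  by (simp add: nrm_def)

lemma nrm_eq_0: "nrm m x = 0 \<longleftrightarrow> (\<forall>i<m. x i = 0)"
  by (auto simp: nrm_L2_set L2_set_eq_0_iff)

lemma nrm_add: "nrm m (\<lambda>t. x t + y t) \<le> nrm m x + nrm m y"
  by (simp add: nrm_L2_set L2_set_triangle_ineq)

lemma nrm_scale: "nrm m (\<lambda>t. c * x t) = \<bar>c\<bar> * nrm m x"
  by (simp add: nrm_def power_mult_distrib sum_distrib_left[symmetric] real_sqrt_mult)

lemma nrm_diff: "nrm m (\<lambda>t. x t - y t) \<le> nrm m x + nrm m y"
  using nrm_add[of m x "\<lambda>t. -1 * y t"] nrm_scale[of m "-1" y] by simp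

lemma abs_le_nrm:
  assumes "i < m"
  shows "\<bar>x i\<bar> \<le> nrm m x"
proof -
  have "(x i)\<^sup>2 \<le> (\<Sum>i<m. (x i)\<^sup>2)"
    using assms by (intro member_le_sum) auto
  then show ?thesis unfolding nrm_def by (intro real_le_rsqrt) simp
qed

lemma abs_ip_le: "\<bar>ip m x y\<bar> \<le> nrm m x * nrm m y"
proof -
  have "\<bar>ip m x y\<bar> \<le> (\<Sum>i<m. \<bar>x i\<bar> * \<bar>y i\<bar>)"
    unfolding ip_def abs_mult[symmetric] by (rule sum_abs)
  also have "\<dots> \<le> nrm m x * nrm m y"
    unfolding nrm_L2_set by (rule L2_set_mult_ineq)
  finally show ?thesis .
qed

lemma ip_le: "ip m x y \<le> nrm m x * nrm m y"
  using abs_ip_le[of m x y] by linarith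

text \<open>Cancels one factor of the norm, also when it vanishes; duality and Cauchy-Schwarz
  arguments end with it.\<close>

lemma nrm_le_of_sq:
  assumes "(nrm m x)\<^sup>2 \<le> c * nrm m x" "0 \<le> c"
  shows "nrm m x \<le> c"
proof (cases "nrm m x = 0")
  case False
  then have "nrm m x > 0" using nrm_nonneg[of m x] by linarith
  then show ?thesis using assms(1) by (simp add: power2_eq_square)
qed (use assms in simp)

text \<open>A matrix and its transpose have the same operator norm: pair
  \<open>lincomb k ?c X\<close> with \<open>x\<close>, where \<open>?c\<close> holds the inner
  products of \<open>x\<close> with the system.\<close>

lemma nrm_adjoint:
  assumes "\<And>c. nrm m (lincomb k c X) \<le> g * nrm k c" "0 \<le> g"
  shows "nrm k (\<lambda>a. ip m (X a) x) \<le> g * nrm m x"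
proof (rule nrm_le_of_sq)
  let ?c = "\<lambda>a. ip m (X a) x"
  have "(nrm k ?c)\<^sup>2 = ip m (lincomb k ?c X) x"
    unfolding ip_lincomb_left nrm_sq by (simp add: power2_eq_square)
  also have "\<dots> \<le> nrm m (lincomb k ?c X) * nrm m x" by (rule ip_le)
  also have "\<dots> \<le> (g * nrm k ?c) * nrm m x" by (intro mult_right_mono assms) auto
  finally show "(nrm k ?c)\<^sup>2 \<le> g * nrm m x * nrm k ?c" by (simp add: mult_ac)
qed (simp add: assms)

lemma ip_orthonormal_lincomb:
  assumes "orthonormal_sys m k X" "a < k"
  shows "ip m (X a) (lincomb k c X) = c a"
proof -
  have "ip m (X a) (lincomb k c X) = (\<Sum>b<k. if b = a then c b else 0)"
    unfolding ip_lincomb_right using assms by (intro sum.cong) (auto simp: orthonormal_sys_def)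
  then show ?thesis using assms by simp
qed

lemma nrm_orthonormal_lincomb:
  assumes "orthonormal_sys m k X"
  shows "nrm m (lincomb k c X) = nrm k c"
proof -
  have "(nrm m (lincomb k c X))\<^sup>2 = (nrm k c)\<^sup>2"
    unfolding ip_self[symmetric] ip_lincomb_left
    using ip_orthonormal_lincomb[OF assms] by (simp add: ip_def)
  then show ?thesis by simp
qed

text \<open>The adjoint of an isometry is a contraction.\<close>

lemma bessel:
  assumes "orthonormal_sys m k X"
  shows "nrm k (\<lambda>a. ip m (X a) x) \<le> nrm m x"
  using nrm_adjoint[of m k X 1 x] nrm_orthonormal_lincomb[OF assms] by simp

text \<open>The residual of the orthogonal projection is orthogonal to the span, so its squared norm
  equals its inner product with any other residual; Cauchy-Schwarz finishes.\<close>

lemma nrm_residual_le: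
  assumes "orthonormal_sys m k X"
  shows "nrm m (\<lambda>t. x t - lincomb k (\<lambda>a. ip m (X a) x) X t) \<le> nrm m (\<lambda>t. x t - lincomb k y X t)"
proof -
  let ?p = "\<lambda>a. ip m (X a) x"
  let ?r = "\<lambda>t. x t - lincomb k ?p X t"
  let ?s = "\<lambda>t. x t - lincomb k y X t"
  have 0: "ip m ?r (lincomb k z X) = 0" for z
    unfolding ip_lincomb_right ip_diff_left
    using ip_orthonormal_lincomb[OF assms]
    by (auto simp: ip_commute[of m x] ip_commute[of m "lincomb k ?p X"] intro!: sum.neutral)
  have "(nrm m ?r)\<^sup>2 = ip m ?r ?s"
    by (simp add: ip_self[symmetric] ip_diff_right 0)
  also have "\<dots> \<le> nrm m ?s * nrm m ?r" using ip_le[of m ?r ?s] by (simp add: mult.commute)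
  finally show ?thesis by (rule nrm_le_of_sq) simp
qed

text \<open>Gaussian elimination by induction on the number of equations: the last one is either
  trivial or eliminates an unknown \<open>q\<close>. This is the dimension count behind the
  Courant-Fischer argument.\<close>

lemma exists_nontrivial_solution:
  fixes A :: "nat \<Rightarrow> nat \<Rightarrow> real"
  shows "\<exists>c. (\<exists>a<Suc m. c a \<noteq> 0) \<and> (\<forall>b<m. (\<Sum>a<Suc m. c a * A a b) = 0)"
proof (induction m arbitrary: A)
  case 0
  show ?case by (rule exI[of _ "\<lambda>_. 1"]) auto
next
  case (Suc m)
  show ?case
  proof (cases "\<forall>a<Suc (Suc m). A a m = 0")
    case True
    obtain c where c: "\<exists>a<Suc m. c a \<noteq> 0" "\<forall>b<m. (\<Sum>a<Suc m. c a * A a b) = 0"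
      using Suc.IH by blast
    define c' where "c' = (\<lambda>a. if a < Suc m then c a else 0)"
    have "(\<Sum>a<Suc (Suc m). c' a * A a b) = (\<Sum>a<Suc m. c a * A a b)" for b
      by (simp add: c'_def)
    moreover have "(\<Sum>a<Suc (Suc m). c' a * A a m) = 0" using True by (intro sum.neutral) simp
    ultimately show ?thesis using c
      by (intro exI[of _ c']) (auto simp: c'_def less_Suc_eq simp del: sum.lessThan_Suc)
  next
    case False
    then obtain q where q: "q < Suc (Suc m)" "A q m \<noteq> 0" by blast
    \<comment> \<open>Enumerates the indices other than the pivot \<open>q\<close>.\<close>
    define s where "s = (\<lambda>a. if a < q then a else Suc a)"
    have bij: "bij_betw s {..<Suc m} ({..<Suc (Suc m)} - {q})"
      by (rule bij_betw_byWitness[where f' = "\<lambda>a. if a < q then a else a - 1"])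
         (use q in \<open>auto simp: s_def\<close>)
    \<comment> \<open>The remaining rows, with column \<open>m\<close> cleared by a multiple of the
      pivot row.\<close>
    define B where "B = (\<lambda>a b. A (s a) b - A (s a) m / A q m * A q b)"
    obtain c where c: "\<exists>a<Suc m. c a \<noteq> 0" "\<forall>b<m. (\<Sum>a<Suc m. c a * B a b) = 0"
      using Suc.IH by blast
    define t where "t = (\<Sum>a<Suc m. c a * A (s a) m)"
    \<comment> \<open>The value at \<open>q\<close> is forced by equation \<open>m\<close>.\<close>
    define c' where "c' = (\<lambda>a. if a = q then - t / A q m else c (if a < q then a else a - 1))"
    have c's: "c' (s a) = c a" for a by (auto simp: c'_def s_def)
    have S: "(\<Sum>a<Suc (Suc m). c' a * A a b) = c' q * A q b + (\<Sum>a<Suc m. c a * A (s a) b)" for b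
    proof -
      have "(\<Sum>a<Suc (Suc m). c' a * A a b) = c' q * A q b + (\<Sum>a\<in>{..<Suc (Suc m)} - {q}. c' a * A a b)"
        using q by (subst sum.remove[of _ q]) auto
      also have "(\<Sum>a\<in>{..<Suc (Suc m)} - {q}. c' a * A a b) = (\<Sum>a<Suc m. c' (s a) * A (s a) b)"
        using sum.reindex_bij_betw[OF bij, of "\<lambda>a. c' a * A a b"] by simp
      finally show ?thesis by (simp add: c's del: sum.lessThan_Suc)
    qed
    have 1: "(\<Sum>a<Suc (Suc m). c' a * A a m) = 0"
      unfolding S using q by (simp add: c'_def t_def del: sum.lessThan_Suc)
    have 2: "(\<Sum>a<Suc (Suc m). c' a * A a b) = 0" if "b < m" for b
    proof -
      have "0 = (\<Sum>a<Suc m. c a * B a b)" using c that by auto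
      also have "\<dots> = (\<Sum>a<Suc m. c a * A (s a) b - c a * A (s a) m * (A q b / A q m))"
        by (intro sum.cong) (auto simp: B_def algebra_simps)
      also have "\<dots> = (\<Sum>a<Suc m. c a * A (s a) b) - t * (A q b / A q m)"
        unfolding sum_subtractf t_def sum_distrib_right ..
      finally show ?thesis unfolding S by (simp add: c'_def)
    qed
    obtain a where "a < Suc m" "c a \<noteq> 0" using c by blast
    then have "s a < Suc (Suc m)" "c' (s a) \<noteq> 0" unfolding c's by (auto simp: s_def)
    with 1 2 show ?thesis by (intro exI[of _ c']) (metis less_antisym)
  qed
qed

section \<open>Maximal Rayleigh quotients\<close>

text \<open>Vectors are functions on all of \<open>nat\<close>. The box is pinned to 0 outside the
  first \<open>m\<close> coordinates, so it is a product of compact intervals and Tychonoff's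
  theorem applies.\<close>

lemma compact_bounded_vectors: "compact {x :: nat \<Rightarrow> real. \<forall>i. \<bar>x i\<bar> \<le> (if i < m then 1 else 0)}"
proof -
  have "compactin (product_topology (\<lambda>_. euclidean) UNIV)
          (PiE (UNIV :: nat set) (\<lambda>i. {- (if i < m then 1 else 0) .. (if i < m then 1 else (0::real))}))"
    unfolding compactin_PiE by auto
  also have "PiE (UNIV :: nat set) (\<lambda>i. {- (if i < m then 1 else 0) .. (if i < m then 1 else (0::real))})
      = {x. \<forall>i. \<bar>x i\<bar> \<le> (if i < m then 1 else 0)}"
    by (auto simp: PiE_def Pi_def abs_le_iff)
  finally show ?thesis by (simp add: euclidean_product_topology)
qed

lemma compact_bounded_matrices:
  "compact {x :: nat \<Rightarrow> nat \<Rightarrow> real. \<forall>a b. \<bar>x a b\<bar> \<le> (if a < m \<and> b < m then 1 else 0)}"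
proof -
  define C where "C = (\<lambda>a. if a < m then {x :: nat \<Rightarrow> real. \<forall>i. \<bar>x i\<bar> \<le> (if i < m then 1 else 0)}
                      else {x. \<forall>i. \<bar>x i\<bar> \<le> (if i < (0::nat) then 1 else 0)})"
  have "compact (C a)" for a
    unfolding C_def using compact_bounded_vectors[of m] compact_bounded_vectors[of 0] by auto
  then have "compactin (product_topology (\<lambda>_. euclidean) UNIV) (PiE (UNIV :: nat set) C)"
    unfolding compactin_PiE by auto
  also have "PiE UNIV C = {x. \<forall>a b. \<bar>x a b\<bar> \<le> (if a < m \<and> b < m then 1 else 0)}"
    unfolding C_def PiE_def Pi_def by (auto split: if_splits)
  finally show ?thesis by (simp add: euclidean_product_topology)
qed

lemma continuous_entry:
  "continuous_on S (\<lambda>x :: nat \<Rightarrow> nat \<Rightarrow> real. x a b)"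
  by (rule continuous_on_product_then_coordinatewise, rule continuous_on_product_then_coordinatewise, rule continuous_on_id)

lemma continuous_coord: "continuous_on S (\<lambda>x :: nat \<Rightarrow> real. x a)"
  by (rule continuous_on_subset[OF continuous_on_product_coordinates]) simp

text \<open>First-order optimality: if \<open>a\<close> were nonzero, a small \<open>s\<close> of
  the same sign would make the linear term exceed the quadratic one.\<close>

lemma linear_le_quadratic_imp_zero:
  fixes a b :: real
  assumes "\<And>s. s * a \<le> s\<^sup>2 * b"
  shows "a = 0"
proof (rule ccontr)
  assume "a \<noteq> 0"
  define B where "B = \<bar>b\<bar> + 1"
  have B: "B > 0" "b < B" by (auto simp: B_def)
  have "(a / B) * a \<le> (a / B)\<^sup>2 * b" by (rule assms)
  then have "a\<^sup>2 * B \<le> a\<^sup>2 * b" using B by (simp add: field_simps power2_eq_square)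
  then have "B \<le> b" using \<open>a \<noteq> 0\<close> by simp
  with B show False by simp
qed

text \<open>The Rayleigh quotient attains its maximum over the (invariant) orthogonal complement of the
  eigenvectors at an eigenvector.\<close>
lemma top_eigenpairs_rayleigh:
  assumes top: "top_eigenpairs n d A U lam"
    and sym: "\<And>i j. i < n \<Longrightarrow> j < n \<Longrightarrow> A i j = A j i"
    and orth: "\<And>a. a < d \<Longrightarrow> (\<Sum>i<n. v i * U i a) = 0"
  shows "ip n v (\<lambda>i. ip n (A i) v) \<le> lam (d - 1) * (nrm n v)\<^sup>2"
proof (cases "nrm n v = 0")
  case True
  then have "\<And>i. i < n \<Longrightarrow> v i = 0" by (simp add: nrm_eq_0)
  then show ?thesis using True by (simp add: ip_def)
next
  case False
  define q where "q = (\<lambda>x. ip n x (\<lambda>i. ip n (A i) x))"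
  define P where "P = (\<lambda>x. \<forall>a<d. (\<Sum>i<n. x i * U i a) = 0)"
  define K where "K = {x. \<forall>i. \<bar>x i\<bar> \<le> (if i < n then 1 else 0)} \<inter> {x. (\<Sum>i<n. (x i)\<^sup>2) = 1}
                   \<inter> (\<Inter>a\<in>{..<d}. {x. (\<Sum>i<n. x i * U i a) = 0})"
  have Asym: "ip n x (\<lambda>i. ip n (A i) y) = ip n y (\<lambda>i. ip n (A i) x)" for x y
    unfolding ip_def sum_distrib_left
    by (subst sum.swap) (auto intro!: sum.cong simp: sym)
  have comp: "compact K"
    unfolding K_def
    by (intro compact_Int_closed compact_bounded_vectors closed_INT ballI closed_Collect_eq
         continuous_intros continuous_coord)
  have cont: "continuous_on K q"
    unfolding q_def ip_def by (intro continuous_intros continuous_coord)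
  have q_scale: "q (\<lambda>i. c * x i) = c\<^sup>2 * q x" for c x
    by (simp add: q_def ip_scale_left ip_scale_right power2_eq_square)
  have inK: "(\<lambda>i. if i < n then x i / nrm n x else 0) \<in> K" if "nrm n x \<noteq> 0" "P x" for x
  proof -
    have pos: "nrm n x > 0" using that(1) nrm_nonneg[of n x] by linarith
    have "\<bar>x i / nrm n x\<bar> \<le> 1" if "i < n" for i
      using abs_le_nrm[OF that, of x] pos by simp
    moreover have "(\<Sum>i<n. (x i / nrm n x)\<^sup>2) = 1"
      using nrm_scale[of n "1 / nrm n x" x] nrm_sq[of n "\<lambda>i. 1 / nrm n x * x i"] pos by simp
    moreover have "(\<Sum>i<n. x i / nrm n x * U i a) = 0" if "a < d" for a
      using \<open>P x\<close> that by (simp add: P_def sum_divide_distrib[symmetric])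
    ultimately show ?thesis by (auto simp: K_def)
  qed
  have Pv: "P v" using orth by (simp add: P_def)
  have "K \<noteq> {}" using inK[OF False Pv] by blast
  then obtain x where x: "x \<in> K" "\<And>y. y \<in> K \<Longrightarrow> q y \<le> q x"
    using continuous_attains_sup[OF comp _ cont] by blast
  have max: "q y \<le> q x * (nrm n y)\<^sup>2" if "P y" for y
  proof (cases "nrm n y = 0")
    case True
    then have "\<And>i. i < n \<Longrightarrow> y i = 0" by (simp add: nrm_eq_0)
    then show ?thesis using True by (simp add: q_def ip_def)
  next
    case F: False
    have "q (\<lambda>i. if i < n then y i / nrm n y else 0) = q (\<lambda>i. (1 / nrm n y) * y i)"
      unfolding q_def by (intro ip_cong) auto
    also have "\<dots> = (1 / nrm n y)\<^sup>2 * q y" by (rule q_scale)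
    finally have "(1 / nrm n y)\<^sup>2 * q y \<le> q x" using x(2)[OF inK[OF F that]] by simp
    then show ?thesis using F by (simp add: field_simps)
  qed
  define \<mu> where "\<mu> = q x"
  define Ax where "Ax = (\<lambda>i. ip n (A i) x)"
  \<comment> \<open>The defect of the eigenvalue equation at the maximiser. It stays in the
    complement because the symmetric \<open>A\<close> preserves the span of the eigenvectors, so it
    is an admissible direction.\<close>
  define h where "h = (\<lambda>i. Ax i - \<mu> * x i)"
  have Px: "P x" and nx: "(nrm n x)\<^sup>2 = 1" using x(1) by (auto simp: K_def P_def nrm_sq)
  have Ph: "P h"
    unfolding P_def
  proof (intro allI impI)
    fix a assume a: "a < d"
    have "(\<Sum>i<n. Ax i * U i a) = ip n (\<lambda>i. U i a) (\<lambda>i. ip n (A i) x)"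
      by (simp add: Ax_def ip_def mult.commute)
    also have "\<dots> = ip n x (\<lambda>i. ip n (A i) (\<lambda>i. U i a))" by (rule Asym)
    also have "\<dots> = ip n x (\<lambda>i. lam a * U i a)"
      using top a by (intro ip_cong) (auto simp: top_eigenpairs_def ip_def)
    also have "\<dots> = 0" using Px a by (simp add: ip_scale_right) (simp add: P_def ip_def)
    finally show "(\<Sum>i<n. h i * U i a) = 0"
      using Px a by (simp add: h_def left_diff_distrib sum_subtractf P_def mult.assoc sum_distrib_left[symmetric])
  qed
  \<comment> \<open>Compares the maximiser \<open>x\<close> with x + s h; the terms linear in s
    combine to 2 s |h|^2.\<close>
  have "s * (2 * (nrm n h)\<^sup>2) \<le> s\<^sup>2 * (\<mu> * (nrm n h)\<^sup>2 - q h)" for s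
  proof -
    let ?y = "\<lambda>i. x i + s * h i"
    have "P ?y" using Px Ph
      by (simp add: P_def distrib_right sum.distrib mult.assoc sum_distrib_left[symmetric])
    then have y1: "q ?y \<le> \<mu> * (nrm n ?y)\<^sup>2" unfolding \<mu>_def by (rule max)
    have y2: "q ?y = \<mu> + 2 * s * ip n h Ax + s\<^sup>2 * q h"
      using Asym[of x h]
      by (simp add: q_def \<mu>_def Ax_def ip_add_left ip_add_right ip_scale_left ip_scale_right algebra_simps power2_eq_square)
    have y3: "(nrm n ?y)\<^sup>2 = 1 + 2 * s * ip n h x + s\<^sup>2 * (nrm n h)\<^sup>2"
      using nx unfolding ip_self[symmetric] ip_add_left ip_add_right ip_scale_left ip_scale_right ip_commute[of n x h]
      by (simp add: algebra_simps power2_eq_square)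
    have "(nrm n h)\<^sup>2 = ip n h Ax - \<mu> * ip n h x"
      using arg_cong[OF h_def, of "ip n h"] by (simp add: ip_self ip_diff_right ip_scale_right)
    then have y4: "ip n h Ax = (nrm n h)\<^sup>2 + \<mu> * ip n h x" by simp
    show ?thesis using y1 unfolding y2 y3 y4 by (simp add: algebra_simps)
  qed
  then have "2 * (nrm n h)\<^sup>2 = 0" by (rule linear_le_quadratic_imp_zero)
  then have "\<forall>i<n. h i = 0" by (simp add: nrm_eq_0)
  then have eig: "\<forall>i<n. (\<Sum>j<n. A i j * x j) = \<mu> * x i" by (simp add: h_def Ax_def ip_def)
  have "\<exists>i<n. x i \<noteq> 0"
  proof (rule ccontr)
    assume "\<not> ?thesis"
    then have "nrm n x = 0" by (simp add: nrm_eq_0)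
    with nx show False by simp
  qed
  \<comment> \<open>The maximality clause of \<open>top_eigenpairs\<close> speaks of eigenvectors
    only, which is why the maximiser had to be shown to be one.\<close>
  then have "\<mu> \<le> lam (d - 1)" using top eig Px unfolding top_eigenpairs_def P_def by blast
  then have "\<mu> * (nrm n v)\<^sup>2 \<le> lam (d - 1) * (nrm n v)\<^sup>2" by (intro mult_right_mono) auto
  moreover have "q v \<le> \<mu> * (nrm n v)\<^sup>2" unfolding \<mu>_def by (rule max[OF Pv])
  ultimately show ?thesis unfolding q_def by linarith
qed

section \<open>Polar factors\<close>

text \<open>Orthogonality is imposed on rows and columns, so that no inverse has to be constructed.\<close>
definition orth2 :: "nat \<Rightarrow> (nat \<Rightarrow> nat \<Rightarrow> real) \<Rightarrow> bool" where
  "orth2 d Q \<longleftrightarrow> (\<forall>a<d. \<forall>b<d. (\<Sum>c<d. Q c a * Q c b) = (if a = b then 1 else 0)) \<and>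
     (\<forall>a<d. \<forall>b<d. (\<Sum>c<d. Q a c * Q b c) = (if a = b then 1 else 0)) \<and>
     (\<forall>a b. (a \<ge> d \<or> b \<ge> d) \<longrightarrow> Q a b = 0)"

text \<open>\<open>Q\<close> times the Householder reflection that negates \<open>x\<close>; the
  zeros outside the block keep the result in the set \<open>orth2 d\<close>.\<close>

definition reflect :: "nat \<Rightarrow> (nat \<Rightarrow> real) \<Rightarrow> (nat \<Rightarrow> nat \<Rightarrow> real) \<Rightarrow> nat \<Rightarrow> nat \<Rightarrow> real" where
  "reflect d x Q a b = (if a < d \<and> b < d then Q a b - 2 / ip d x x * ip d (Q a) x * x b else 0)"

text \<open>The trace of Q^T H, the objective that the polar factor maximises.\<close>

definition tr_prod :: "nat \<Rightarrow> (nat \<Rightarrow> nat \<Rightarrow> real) \<Rightarrow> (nat \<Rightarrow> nat \<Rightarrow> real) \<Rightarrow> real" where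
  "tr_prod d Q H = (\<Sum>a<d. \<Sum>b<d. Q a b * H a b)"

definition tmul :: "nat \<Rightarrow> (nat \<Rightarrow> nat \<Rightarrow> real) \<Rightarrow> (nat \<Rightarrow> nat \<Rightarrow> real) \<Rightarrow> nat \<Rightarrow> nat \<Rightarrow> real" where
  "tmul d Q H c b = (\<Sum>a<d. Q a c * H a b)"

definition bil :: "nat \<Rightarrow> (nat \<Rightarrow> nat \<Rightarrow> real) \<Rightarrow> (nat \<Rightarrow> real) \<Rightarrow> (nat \<Rightarrow> real) \<Rightarrow> real" where
  "bil d S x y = (\<Sum>c<d. \<Sum>b<d. x c * S c b * y b)"

lemma bil_add: "bil d S (\<lambda>i. x i + u * z i) y = bil d S x y + u * bil d S z y"
               "bil d S y (\<lambda>i. x i + u * z i) = bil d S y x + u * bil d S y z"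
  by (simp_all add: bil_def algebra_simps sum.distrib sum_distrib_left)

text \<open>With P the reflection along \<open>x\<close>, (Q P)^T H = P Q^T H because P is
  symmetric; expanding P gives the formula.\<close>

lemma bil_reflect:
  "bil d (tmul d (reflect d x Q) H) y y
     = bil d (tmul d Q H) y y - 2 / ip d x x * ip d x y * bil d (tmul d Q H) x y"
proof -
  define k where "k = 2 / ip d x x"
  have T: "tmul d (reflect d x Q) H c b = tmul d Q H c b - k * x c * (\<Sum>e<d. x e * tmul d Q H e b)"
    if "c < d" for c b
  proof -
    have "tmul d (reflect d x Q) H c b = (\<Sum>a<d. Q a c * H a b - k * x c * (ip d (Q a) x * H a b))"
      unfolding tmul_def using that by (intro sum.cong) (auto simp: reflect_def k_def algebra_simps)
    also have "\<dots> = tmul d Q H c b - k * x c * (\<Sum>a<d. ip d (Q a) x * H a b)"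
      by (simp add: sum_subtractf tmul_def sum_distrib_left)
    also have "(\<Sum>a<d. ip d (Q a) x * H a b) = (\<Sum>e<d. x e * tmul d Q H e b)"
      unfolding ip_def tmul_def sum_distrib_left sum_distrib_right
      by (subst sum.swap) (simp add: mult_ac)
    finally show ?thesis .
  qed
  have "bil d (tmul d (reflect d x Q) H) y y
      = (\<Sum>c<d. \<Sum>b<d. y c * tmul d Q H c b * y b
           - k * (x c * y c) * (\<Sum>e<d. x e * tmul d Q H e b * y b))"
    unfolding bil_def by (intro sum.cong) (auto simp: T algebra_simps sum_distrib_left)
  also have "\<dots> = bil d (tmul d Q H) y y
      - (\<Sum>c<d. \<Sum>b<d. k * (x c * y c) * (\<Sum>e<d. x e * tmul d Q H e b * y b))"
    by (simp add: sum_subtractf bil_def)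
  also have "(\<Sum>c<d. \<Sum>b<d. k * (x c * y c) * (\<Sum>e<d. x e * tmul d Q H e b * y b))
      = k * ip d x y * (\<Sum>b<d. \<Sum>e<d. x e * tmul d Q H e b * y b)"
    by (simp only: ip_def sum_distrib_left[symmetric] sum_distrib_right[symmetric])
  also have "(\<Sum>b<d. \<Sum>e<d. x e * tmul d Q H e b * y b) = bil d (tmul d Q H) x y"
    unfolding bil_def by (rule sum.swap)
  finally show ?thesis by (simp add: k_def)
qed

lemma tr_prod_reflect:
  "tr_prod d (reflect d x Q) H = tr_prod d Q H - 2 / ip d x x * bil d (tmul d Q H) x x"
proof -
  define k where "k = 2 / ip d x x"
  have r: "reflect d x Q a b = Q a b - k * ip d (Q a) x * x b" if "a < d" "b < d" for a b
    using that by (simp add: reflect_def k_def)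
  have "tr_prod d (reflect d x Q) H = (\<Sum>a<d. \<Sum>b<d. Q a b * H a b - k * (\<Sum>c<d. Q a c * x c * x b * H a b))"
    unfolding tr_prod_def
    by (intro sum.cong) (auto simp: r ip_def algebra_simps sum_distrib_left)
  also have "\<dots> = tr_prod d Q H - k * (\<Sum>a<d. \<Sum>b<d. \<Sum>c<d. Q a c * x c * x b * H a b)"
    by (simp add: sum_subtractf tr_prod_def sum_distrib_left)
  also have "(\<Sum>a<d. \<Sum>b<d. \<Sum>c<d. Q a c * x c * x b * H a b)
     = (\<Sum>a<d. \<Sum>c<d. \<Sum>b<d. Q a c * x c * x b * H a b)"
    by (intro sum.cong refl sum.swap)
  also have "\<dots> = (\<Sum>c<d. \<Sum>a<d. \<Sum>b<d. Q a c * x c * x b * H a b)"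
    by (rule sum.swap)
  also have "\<dots> = (\<Sum>c<d. \<Sum>b<d. \<Sum>a<d. Q a c * x c * x b * H a b)"
    by (intro sum.cong refl sum.swap)
  also have "\<dots> = bil d (tmul d Q H) x x"
    unfolding bil_def tmul_def by (simp add: sum_distrib_left sum_distrib_right mult_ac)
  finally show ?thesis by (simp add: k_def)
qed

lemma orth2_reflect:
  assumes Q: "orth2 d Q" and x: "ip d x x \<noteq> 0"
  shows "orth2 d (reflect d x Q)"
proof -
  define k where "k = 2 / ip d x x"
  define y where "y = (\<lambda>a. ip d (Q a) x)"
  have kx: "k * ip d x x = 2" using x by (simp add: k_def)
  have r: "reflect d x Q a b = Q a b - k * y a * x b" if "a < d" "b < d" for a b
    using that by (simp add: reflect_def k_def y_def)
  \<comment> \<open>Q^T (Q x) = x, and hence |Q x| = |x|. With k |x|^2 = 2 the linear corrections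
    then cancel the quadratic one.\<close>
  have Qty: "(\<Sum>c<d. Q c a * y c) = x a" if "a < d" for a
  proof -
    have "(\<Sum>c<d. Q c a * y c) = (\<Sum>e<d. (\<Sum>c<d. Q c a * Q c e) * x e)"
      unfolding y_def ip_def sum_distrib_left sum_distrib_right
      by (subst sum.swap) (simp add: mult_ac)
    also have "\<dots> = (\<Sum>e<d. if e = a then x e else 0)"
      using Q that by (intro sum.cong) (auto simp: orth2_def)
    finally show ?thesis using that by simp
  qed
  have yy: "ip d y y = ip d x x"
  proof -
    have "ip d y y = (\<Sum>c<d. \<Sum>a<d. Q c a * x a * y c)"
      by (subst y_def) (simp add: ip_def sum_distrib_right)
    also have "\<dots> = (\<Sum>a<d. x a * (\<Sum>c<d. Q c a * y c))"
      by (subst sum.swap) (simp add: sum_distrib_left mult_ac)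
    also have "\<dots> = ip d x x" unfolding ip_def using Qty by (intro sum.cong) auto
    finally show ?thesis .
  qed
  have "(\<Sum>c<d. reflect d x Q c a * reflect d x Q c b) = (if a = b then 1 else 0)"
    if ab: "a < d" "b < d" for a b
  proof -
    have "(\<Sum>c<d. reflect d x Q c a * reflect d x Q c b)
        = (\<Sum>c<d. Q c a * Q c b - k * x b * (Q c a * y c) - k * x a * (Q c b * y c) + k * k * x a * x b * (y c * y c))"
      using ab by (intro sum.cong) (auto simp: r algebra_simps)
    also have "\<dots> = (\<Sum>c<d. Q c a * Q c b) - k * x b * (\<Sum>c<d. Q c a * y c)
        - k * x a * (\<Sum>c<d. Q c b * y c) + k * x a * x b * (k * ip d y y)"
      by (simp add: sum.distrib sum_subtractf sum_distrib_left ip_def mult_ac)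
    also have "\<dots> = (\<Sum>c<d. Q c a * Q c b)"
      using ab by (simp add: Qty yy kx)
    finally show ?thesis using Q ab by (simp add: orth2_def)
  qed
  moreover have "(\<Sum>c<d. reflect d x Q a c * reflect d x Q b c) = (if a = b then 1 else 0)"
    if ab: "a < d" "b < d" for a b
  proof -
    have "(\<Sum>c<d. reflect d x Q a c * reflect d x Q b c)
        = (\<Sum>c<d. Q a c * Q b c - k * y b * (Q a c * x c) - k * y a * (Q b c * x c) + k * k * y a * y b * (x c * x c))"
      using ab by (intro sum.cong) (auto simp: r algebra_simps)
    also have "\<dots> = (\<Sum>c<d. Q a c * Q b c) - k * y b * y a - k * y a * y b + k * y a * y b * (k * ip d x x)"
      by (subst (2 3) y_def) (simp add: sum.distrib sum_subtractf sum_distrib_left ip_def mult_ac)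
    also have "\<dots> = (\<Sum>c<d. Q a c * Q b c)" by (simp add: kx)
    finally show ?thesis using Q ab by (simp add: orth2_def)
  qed
  moreover have "reflect d x Q a b = 0" if "a \<ge> d \<or> b \<ge> d" for a b
    using that by (auto simp: reflect_def)
  ultimately show ?thesis unfolding orth2_def by blast
qed

lemma orth2_entry_le:
  assumes "orth2 d Q" shows "\<bar>Q a b\<bar> \<le> (if a < d \<and> b < d then 1 else 0)"
proof (cases "a < d \<and> b < d")
  case True
  then have "ip d (Q a) (Q a) = 1"
    using assms by (simp add: orth2_def ip_def)
  then have "(nrm d (Q a))\<^sup>2 = 1" by (simp add: ip_self)
  then have "nrm d (Q a) = 1"
    using nrm_nonneg[of d "Q a"] by (simp add: power2_eq_1_iff)
  then show ?thesis using abs_le_nrm[of b d "Q a"] True by simp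
next
  case False
  then show ?thesis using assms by (auto simp: orth2_def)
qed

lemma compact_orth2: "compact {Q. orth2 d Q}"
proof -
  let ?B = "{x :: nat \<Rightarrow> nat \<Rightarrow> real. \<forall>a b. \<bar>x a b\<bar> \<le> (if a < d \<and> b < d then 1 else 0)}"
  let ?C = "\<Inter>a\<in>{..<d}. \<Inter>b\<in>{..<d}. {Q. (\<Sum>c<d. Q c a * Q c b) = (if a = b then 1 else 0)}"
  let ?R = "\<Inter>a\<in>{..<d}. \<Inter>b\<in>{..<d}. {Q. (\<Sum>c<d. Q a c * Q b c) = (if a = b then 1 else 0)}"
  have "compact (?B \<inter> ?C \<inter> ?R)"
    by (intro compact_Int_closed compact_bounded_matrices closed_INT ballI closed_Collect_eq
         continuous_on_sum continuous_on_mult continuous_entry continuous_on_const)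
  also have "?B \<inter> ?C \<inter> ?R = {Q. orth2 d Q}"
  proof (intro set_eqI iffI)
    fix Q assume "Q \<in> ?B \<inter> ?C \<inter> ?R"
    then have Q: "Q \<in> ?B" "Q \<in> ?C" "Q \<in> ?R" by blast+
    have "Q a b = 0" if "a \<ge> d \<or> b \<ge> d" for a b
    proof -
      have "\<bar>Q a b\<bar> \<le> (if a < d \<and> b < d then 1 else 0)" using Q(1) by blast
      then show ?thesis using that by auto
    qed
    then show "Q \<in> {Q. orth2 d Q}" using Q(2,3) unfolding orth2_def by blast
  next
    fix Q assume "Q \<in> {Q. orth2 d Q}"
    then have Q: "orth2 d Q" by simp
    have "Q \<in> ?B" using orth2_entry_le[OF Q] by simp
    moreover have "Q \<in> ?C" "Q \<in> ?R" using Q by (simp_all add: orth2_def)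
    ultimately show "Q \<in> ?B \<inter> ?C \<inter> ?R" by blast
  qed
  finally show ?thesis .
qed

lemma orth2_identity: "orth2 d (\<lambda>a b. if a = b \<and> a < d then 1 else 0)"
proof -
  have "(\<Sum>c<d. (if c = a \<and> c < d then 1 else 0) * (if c = b \<and> c < d then 1 else 0)) = (if a = b then 1 else (0::real))"
    if "a < d" for a b
  proof -
    have "(\<Sum>c<d. (if c = a \<and> c < d then 1 else 0) * (if c = b \<and> c < d then 1 else (0::real)))
       = (\<Sum>c<d. if c = a then (if a = b then 1 else 0) else 0)"
      by (intro sum.cong) auto
    then show ?thesis using that by simp
  qed
  note 1 = this
  have "(\<Sum>c<d. (if a = c \<and> a < d then 1 else 0) * (if b = c \<and> b < d then 1 else 0)) = (if a = b then 1 else (0::real))"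
    if "a < d" "b < d" for a b
    using that by (subst 1[OF that(1), of b, symmetric]) (auto intro!: sum.cong)
  with 1 show ?thesis unfolding orth2_def by auto
qed

text \<open>The polar factor arises as the maximiser of \<open>tr (Q\<^sup>T H)\<close>: first-order optimality with
  respect to rotations makes \<open>Q\<^sup>T H\<close> symmetric, optimality with respect to reflections makes it
  positive semidefinite.\<close>
lemma polar_factor:
  obtains Q where "orth2 d Q"
    "\<And>a b. a < d \<Longrightarrow> b < d \<Longrightarrow> tmul d Q H a b = tmul d Q H b a"
    "\<And>x. 0 \<le> bil d (tmul d Q H) x x"
proof -
  have cont: "continuous_on {Q. orth2 d Q} (\<lambda>Q. tr_prod d Q H)"
    unfolding tr_prod_def
    by (intro continuous_on_sum continuous_on_mult continuous_entry continuous_on_const)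
  have ne: "{Q. orth2 d Q} \<noteq> {}" using orth2_identity by blast
  obtain Q where Q: "orth2 d Q" and max: "\<And>Q'. orth2 d Q' \<Longrightarrow> tr_prod d Q' H \<le> tr_prod d Q H"
    using continuous_attains_sup[OF compact_orth2 ne cont] by auto
  define S where "S = tmul d Q H"
  have psd: "0 \<le> bil d S x x" for x
  proof (cases "ip d x x = 0")
    case True
    then have "\<forall>i<d. x i = 0" by (simp add: ip_self nrm_eq_0)
    then show ?thesis by (simp add: bil_def)
  next
    case False
    then have "ip d x x > 0" using ip_self[of d x] by (metis less_eq_real_def zero_le_power2)
    \<comment> \<open>A single reflection cannot increase the maximal trace, so the form is
      nonnegative along \<open>x\<close>.\<close>
    moreover have "2 / ip d x x * bil d S x x \<ge> 0"
      using max[OF orth2_reflect[OF Q False]] by (simp add: tr_prod_reflect S_def)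
    ultimately show ?thesis by (simp add: zero_le_mult_iff zero_le_divide_iff)
  qed
  have sym: "S a b = S b a" if ab: "a < d" "b < d" "a \<noteq> b" for a b
  proof -
    define e where "e = (\<lambda>(a::nat) i. if i = a then 1 else (0::real))"
    have ee: "ip d (e p) (e q) = (if p = q then 1 else 0)" if "p < d" for p q
    proof -
      have "ip d (e p) (e q) = (\<Sum>i<d. if i = p then (if p = q then 1 else 0) else 0)"
        unfolding ip_def e_def by (intro sum.cong) auto
      then show ?thesis using that by simp
    qed
    have be: "bil d S (e p) (e q) = S p q" if "p < d" "q < d" for p q
    proof -
      have "(\<Sum>b<d. e p c * S c b * e q b) = (\<Sum>b<d. if b = q then e p c * S c q else 0)" for c
        unfolding e_def by (intro sum.cong) auto
      then have "bil d S (e p) (e q) = (\<Sum>c<d. e p c * S c q)"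
        unfolding bil_def using that by simp
      also have "\<dots> = (\<Sum>c<d. if c = p then S p q else 0)"
        unfolding e_def by (intro sum.cong) auto
      finally show ?thesis using that by simp
    qed
    have "u * (S a b - S b a) \<le> u\<^sup>2 * (S a a + S b b)" for u
    proof -
      \<comment> \<open>Reflecting along e_a and then along e_a + u e_b is a rotation of the (a, b)
        plane, the identity at u = 0. To first order in u it changes the trace by a multiple of the
        antisymmetric part of \<open>S\<close>.\<close>
      let ?y = "\<lambda>i. e a i + u * e b i"
      have xx: "ip d (e a) (e a) = 1" using ee ab by simp
      have yy: "ip d ?y ?y = 1 + u\<^sup>2" and xy: "ip d (e a) ?y = 1"
        using ab by (simp_all add: ip_add_left ip_add_right ip_scale_left ip_scale_right ee power2_eq_square)
      have pos: "1 + u\<^sup>2 > 0" by (simp add: add_pos_nonneg)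
      have "orth2 d (reflect d ?y (reflect d (e a) Q))"
        using xx yy pos by (intro orth2_reflect Q) auto
      from max[OF this] have
        "0 \<le> 2 * S a a + 2 / (1 + u\<^sup>2) * (bil d S ?y ?y - 2 * bil d S (e a) ?y)"
        by (simp add: tr_prod_reflect bil_reflect xx yy xy S_def[symmetric] be ab algebra_simps)
      also have "bil d S ?y ?y - 2 * bil d S (e a) ?y = u * (S b a - S a b) + u\<^sup>2 * S b b - S a a"
        using ab by (simp add: bil_add be algebra_simps power2_eq_square)
      finally have "0 \<le> (1 + u\<^sup>2) * (2 * S a a + 2 / (1 + u\<^sup>2) * (u * (S b a - S a b) + u\<^sup>2 * S b b - S a a))"
        using pos by (intro mult_nonneg_nonneg) auto
      also have "\<dots> = 2 * (1 + u\<^sup>2) * S a a + 2 * (u * (S b a - S a b) + u\<^sup>2 * S b b - S a a)"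
        using pos by (simp add: field_simps)
      finally show ?thesis by (simp add: algebra_simps)
    qed
    from linear_le_quadratic_imp_zero[OF this] show ?thesis by simp
  qed
  show ?thesis
    using that[OF Q] sym psd unfolding S_def by metis
qed

text \<open>If H = Q S with S symmetric positive semidefinite, then H^T H - I = (S + I) (S - I).
  Since S + I dominates I, |H - Q| = |S - I| is at most |H^T H - I|.\<close>

lemma polar_bound:
  assumes HH: "\<And>z. nrm d (\<lambda>b. ip d (tmul d H H b) z - z b) \<le> e * nrm d z"
  obtains Q where "Q \<in> orth_mats d"
    "\<And>x. nrm d (\<lambda>b. \<Sum>a<d. x a * Q a b) = nrm d x"
    "\<And>x. nrm d (\<lambda>b. \<Sum>a<d. x a * (H a b - Q a b)) \<le> e * nrm d x"
proof -
  obtain Q where Q: "orth2 d Q"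
    and sym: "\<And>a b. a < d \<Longrightarrow> b < d \<Longrightarrow> tmul d Q H a b = tmul d Q H b a"
    and psd: "\<And>x. 0 \<le> bil d (tmul d Q H) x x"
    using polar_factor[of d H] by metis
  define S where "S = tmul d Q H"
  have HQS: "H a b = (\<Sum>c<d. Q a c * S c b)" if "a < d" for a b
  proof -
    have "(\<Sum>c<d. Q a c * S c b) = (\<Sum>e<d. (\<Sum>c<d. Q a c * Q e c) * H e b)"
      unfolding S_def tmul_def sum_distrib_left sum_distrib_right
      by (subst sum.swap) (simp add: mult_ac)
    also have "\<dots> = (\<Sum>e<d. if e = a then H e b else 0)"
      using Q that by (intro sum.cong) (auto simp: orth2_def)
    finally show ?thesis using that by simp
  qed
  have SS: "(\<Sum>c<d. S c a * S c b) = tmul d H H a b" if "a < d" "b < d" for a b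
  proof -
    have "tmul d H H a b = (\<Sum>e<d. (\<Sum>c<d. Q e c * S c a) * H e b)"
      unfolding tmul_def by (intro sum.cong) (auto simp flip: HQS)
    also have "\<dots> = (\<Sum>c<d. S c a * S c b)"
      unfolding S_def[unfolded tmul_def, THEN fun_cong, THEN fun_cong, of _ b]
        sum_distrib_left sum_distrib_right
      by (subst sum.swap) (simp add: mult_ac)
    finally show ?thesis by simp
  qed
  have iso: "nrm d (\<lambda>b. \<Sum>a<d. x a * Q a b) = nrm d x" for x
  proof -
    have "orthonormal_sys d d Q" using Q by (simp add: orth2_def orthonormal_sys_def ip_def)
    then show ?thesis using nrm_orthonormal_lincomb[of d d Q x] by (simp add: lincomb_def[abs_def])
  qed
  have close: "nrm d (\<lambda>b. \<Sum>a<d. x a * (H a b - Q a b)) \<le> e * nrm d x" for x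
  proof -
    \<comment> \<open>z = Q^T x turns x^T (H - Q) into z^T (S - I), which is
      \<open>v\<close>.\<close>
    define z where "z = (\<lambda>c. \<Sum>a<d. x a * Q a c)"
    define v where "v = (\<lambda>b. ip d (S b) z - z b)"
    define w where "w = (\<lambda>b. ip d (tmul d H H b) z - z b)"
    have v: "(\<Sum>a<d. x a * (H a b - Q a b)) = v b" if "b < d" for b
    proof -
      have "(\<Sum>a<d. x a * (H a b - Q a b)) = (\<Sum>a<d. \<Sum>c<d. x a * Q a c * S c b) - z b"
        by (simp add: right_diff_distrib sum_subtractf z_def HQS sum_distrib_left mult.assoc)
      also have "(\<Sum>a<d. \<Sum>c<d. x a * Q a c * S c b) = (\<Sum>c<d. z c * S c b)"
        unfolding z_def sum_distrib_right by (rule sum.swap)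
      also have "\<dots> = ip d (S b) z"
        unfolding ip_def using sym that by (intro sum.cong) (auto simp: S_def)
      finally show ?thesis by (simp add: v_def)
    qed
    \<comment> \<open>(S + I) v = (H^T H - I) z. Pairing with \<open>v\<close> and dropping the
      nonnegative v^T S v bounds |v|.\<close>
    have Sv: "ip d (S c) v + v c = w c" if c: "c < d" for c
    proof -
      have "ip d (S c) (\<lambda>b. ip d (S b) z) = (\<Sum>e<d. (\<Sum>b<d. S c b * S b e) * z e)"
        unfolding ip_def sum_distrib_left sum_distrib_right
        by (subst sum.swap) (simp add: mult_ac)
      also have "\<dots> = (\<Sum>e<d. (\<Sum>b<d. S b c * S b e) * z e)"
        using sym c by (intro sum.cong arg_cong2[of _ _ _ _ "(*)"]) (auto simp: S_def)
      also have "\<dots> = ip d (tmul d H H c) z"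
        unfolding ip_def using c by (intro sum.cong) (auto simp: SS)
      finally have "ip d (S c) (\<lambda>b. ip d (S b) z) = ip d (tmul d H H c) z" .
      then show ?thesis by (simp add: v_def w_def ip_diff_right)
    qed
    have "(nrm d v)\<^sup>2 \<le> (nrm d v)\<^sup>2 + bil d S v v" using psd by (simp add: S_def)
    also have "\<dots> = ip d v w"
    proof -
      have "bil d S v v = ip d v (\<lambda>c. ip d (S c) v)"
        by (simp add: bil_def ip_def sum_distrib_left mult.assoc)
      then have "(nrm d v)\<^sup>2 + bil d S v v = ip d v (\<lambda>c. ip d (S c) v + v c)"
        by (simp add: ip_add_right ip_self)
      also have "\<dots> = ip d v w" by (intro ip_cong) (auto simp: Sv)
      finally show ?thesis .
    qed
    also have "\<dots> \<le> nrm d w * nrm d v" using ip_le[of d v w] by (simp add: mult.commute)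
    finally have "nrm d v \<le> nrm d w" by (rule nrm_le_of_sq) simp
    also have "\<dots> \<le> e * nrm d z" unfolding w_def by (rule HH)
    also have "nrm d z = nrm d x" unfolding z_def by (rule iso)
    finally have "nrm d v \<le> e * nrm d x" .
    moreover have "nrm d (\<lambda>b. \<Sum>a<d. x a * (H a b - Q a b)) = nrm d v"
      by (intro nrm_cong v)
    ultimately show ?thesis by simp
  qed
  have "Q \<in> orth_mats d" using Q by (auto simp: orth_mats_def orthonormal_cols_def orth2_def)
  from that[OF this iso close] show ?thesis .
qed

section \<open>Perturbation of the row embedding\<close>

lemma nrm_mult_le:
  assumes "\<And>i. i < m \<Longrightarrow> \<bar>f i\<bar> \<le> B"
  shows "nrm m (\<lambda>i. f i * x i) \<le> B * nrm m x"
proof (cases "m = 0")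
  case False
  then have B: "B \<ge> 0" using assms[of 0] by linarith
  have "(f i * x i)\<^sup>2 \<le> (B * x i)\<^sup>2" if "i < m" for i
    unfolding power_mult_distrib
    using assms[OF that] B by (intro mult_right_mono) (auto simp: abs_le_square_iff[symmetric])
  then have "nrm m (\<lambda>i. f i * x i) \<le> nrm m (\<lambda>i. B * x i)"
    unfolding nrm_def by (intro real_sqrt_le_mono sum_mono) auto
  then show ?thesis using B by (simp add: nrm_scale)
qed (simp add: nrm_def)

section \<open>Singular vectors of the signal\<close>

locale signal_rows =
  fixes n T d :: nat and Y U :: "nat \<Rightarrow> nat \<Rightarrow> real" and lamS :: "nat \<Rightarrow> real"
  assumes d_pos: "0 < d"
    and Y_unit: "\<And>i. i < n \<Longrightarrow> nrm T (Y i) = 1"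
    and U_orth: "orthonormal_cols n d U"
    and lam_pos: "\<And>a. a < d \<Longrightarrow> lamS a > 0"
    and lam_dec: "\<And>a b. a \<le> b \<Longrightarrow> b < d \<Longrightarrow> lamS b \<le> lamS a"
    and decomp: "\<And>i j. i < n \<Longrightarrow> j < n \<Longrightarrow> ip T (Y i) (Y j) = (\<Sum>a<d. U i a * lamS a * U j a)"
begin

text \<open>The right singular vectors, that is the columns of Y^T U Lambda^(-1/2).\<close>

definition V :: "nat \<Rightarrow> nat \<Rightarrow> real" where
  "V a = lincomb n (\<lambda>i. U i a / sqrt (lamS a)) Y"

abbreviation X :: "nat \<Rightarrow> nat \<Rightarrow> real" where
  "X \<equiv> embed U lamS"

lemma U_sum: "a < d \<Longrightarrow> b < d \<Longrightarrow> (\<Sum>i<n. U i a * U i b) = (if a = b then 1 else 0)"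
  using U_orth by (simp add: orthonormal_cols_def)

text \<open>Y Y^T U = U Lambda gives Y V = U Lambda^(1/2): the embedding holds the coordinates of
  the rows of \<open>Y\<close> in the system \<open>V\<close>.\<close>

lemma ip_V_Y:
  assumes "a < d" "i < n"
  shows "ip T (V a) (Y i) = X i a"
proof -
  have "ip T (V a) (Y i) = (\<Sum>j<n. U j a / sqrt (lamS a) * (\<Sum>b<d. U j b * lamS b * U i b))"
    unfolding V_def ip_lincomb_left using assms by (simp add: decomp)
  also have "\<dots> = (\<Sum>b<d. (\<Sum>j<n. U j a * U j b) * (lamS b * U i b / sqrt (lamS a)))"
    unfolding sum_distrib_left sum_distrib_right by (subst sum.swap) (simp add: mult_ac)
  also have "\<dots> = (\<Sum>b<d. if b = a then lamS b * U i b / sqrt (lamS a) else 0)"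
    using assms by (intro sum.cong) (auto simp: U_sum)
  also have "\<dots> = lamS a / sqrt (lamS a) * U i a" using assms by simp
  also have "\<dots> = X i a" using lam_pos[OF assms(1)] by (simp add: embed_def real_div_sqrt)
  finally show ?thesis .
qed

lemma V_orth: "orthonormal_sys T d V"
  unfolding orthonormal_sys_def
proof (intro allI impI)
  fix a b assume ab: "a < d" "b < d"
  have "ip T (V a) (V b) = (\<Sum>i<n. U i b / sqrt (lamS b) * X i a)"
    by (subst (2) V_def) (simp add: ip_lincomb_right ip_V_Y ab)
  also have "\<dots> = (\<Sum>i<n. U i b * U i a) * (sqrt (lamS a) / sqrt (lamS b))"
    by (simp add: embed_def sum_distrib_left sum_divide_distrib mult_ac)
  also have "\<dots> = (if a = b then 1 else 0)"
    using U_sum[OF ab(2,1)] lam_pos[OF ab(2)] by auto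
  finally show "ip T (V a) (V b) = (if a = b then 1 else 0)" .
qed

text \<open>The squared norm is a diagonal entry of Y Y^T.\<close>

lemma nrm_X:
  assumes "i < n" shows "nrm d (X i) = 1"
proof -
  have "(nrm d (X i))\<^sup>2 = (\<Sum>a<d. U i a * lamS a * U i a)"
    unfolding nrm_sq embed_def using lam_pos
    by (intro sum.cong) (auto simp: power_mult_distrib less_imp_le power2_eq_square)
  also have "\<dots> = 1" using decomp[OF assms assms] Y_unit[OF assms] by (simp add: ip_self)
  finally show ?thesis using nrm_nonneg[of d "X i"] by (simp add: power2_eq_1_iff)
qed

text \<open>The residual has squared norm 1 - 2 + 1 = 0, so the rows of \<open>Y\<close> lie in the
  span of \<open>V\<close>.\<close>

lemma Y_expand:
  assumes "i < n" "t < T"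
  shows "Y i t = lincomb d (X i) V t"
proof -
  let ?r = "\<lambda>t. Y i t - lincomb d (X i) V t"
  have "ip T (Y i) (lincomb d (X i) V) = (nrm d (X i))\<^sup>2"
    unfolding ip_lincomb_right nrm_sq using assms
    by (intro sum.cong) (auto simp: ip_V_Y ip_commute[of T "Y i"] power2_eq_square)
  moreover have "ip T (lincomb d (X i) V) (lincomb d (X i) V) = (nrm d (X i))\<^sup>2"
    unfolding ip_self nrm_orthonormal_lincomb[OF V_orth] ..
  ultimately have "ip T ?r ?r = 0"
    using Y_unit[OF assms(1)] nrm_X[OF assms(1)]
    by (simp add: ip_diff_left ip_diff_right ip_commute[of T "lincomb d (X i) V" "Y i"] ip_self)
  then show ?thesis using assms(2) by (simp add: ip_self nrm_eq_0)
qed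

lemma lincomb_Y:
  assumes "t < T"
  shows "lincomb n x Y t = lincomb d (\<lambda>a. \<Sum>i<n. x i * X i a) V t"
proof -
  have "lincomb n x Y t = (\<Sum>i<n. \<Sum>a<d. x i * X i a * V a t)"
    unfolding lincomb_def
    using Y_expand[OF _ assms] by (intro sum.cong) (auto simp: lincomb_def sum_distrib_left mult.assoc)
  also have "\<dots> = lincomb d (\<lambda>a. \<Sum>i<n. x i * X i a) V t"
    unfolding lincomb_def sum_distrib_right by (rule sum.swap)
  finally show ?thesis .
qed

lemma nrm_lincomb_Y:
  "nrm T (lincomb n x Y) = nrm d (\<lambda>a. sqrt (lamS a) * (\<Sum>i<n. x i * U i a))"
proof -
  have "nrm T (lincomb n x Y) = nrm T (lincomb d (\<lambda>a. \<Sum>i<n. x i * X i a) V)"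
    by (intro nrm_cong lincomb_Y)
  also have "\<dots> = nrm d (\<lambda>a. \<Sum>i<n. x i * X i a)"
    by (rule nrm_orthonormal_lincomb[OF V_orth])
  also have "\<dots> = nrm d (\<lambda>a. sqrt (lamS a) * (\<Sum>i<n. x i * U i a))"
    by (intro nrm_cong) (simp add: embed_def sum_distrib_left mult_ac)
  finally show ?thesis .
qed

lemma U_sys: "orthonormal_sys n d (\<lambda>a i. U i a)"
  using U_orth by (simp add: orthonormal_sys_def orthonormal_cols_def ip_def)

lemma nrm_lincomb_Y_upper: "nrm T (lincomb n x Y) \<le> sqrt (lamS 0) * nrm n x"
proof -
  have "nrm T (lincomb n x Y) \<le> sqrt (lamS 0) * nrm d (\<lambda>a. ip n (\<lambda>i. U i a) x)"
    unfolding nrm_lincomb_Y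
    using nrm_mult_le[of d "\<lambda>a. sqrt (lamS a)" "sqrt (lamS 0)" "\<lambda>a. \<Sum>i<n. x i * U i a"]
      lam_dec[of 0] lam_pos by (simp add: ip_def mult.commute less_imp_le)
  also have "\<dots> \<le> sqrt (lamS 0) * nrm n x"
    using lam_pos[OF d_pos] by (intro mult_left_mono bessel[OF U_sys]) (auto simp: less_imp_le)
  finally show ?thesis .
qed

text \<open>U^T recovers the coefficients of a vector in the column span of \<open>U\<close>, and
  Lambda^(1/2) stretches each by at least the root of the last eigenvalue.\<close>

lemma nrm_lincomb_Y_lower:
  "sqrt (lamS (d - 1)) * nrm d c \<le> nrm T (lincomb n (lincomb d c (\<lambda>a i. U i a)) Y)"
proof -
  have "sqrt (lamS (d - 1)) * nrm d c = nrm d (\<lambda>a. sqrt (lamS (d - 1)) * c a)"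
    using lam_pos[of "d - 1"] d_pos by (simp add: nrm_scale)
  also have "\<dots> \<le> nrm d (\<lambda>a. sqrt (lamS a) * c a)"
    unfolding nrm_def
  proof (intro real_sqrt_le_mono sum_mono)
    fix a assume "a \<in> {..<d}"
    then have "lamS (d - 1) \<le> lamS a" "0 \<le> lamS (d - 1)" using lam_dec[of a "d - 1"] lam_pos[of "d - 1"] by auto
    then show "(sqrt (lamS (d - 1)) * c a)\<^sup>2 \<le> (sqrt (lamS a) * c a)\<^sup>2"
      by (simp add: power_mult_distrib mult_right_mono)
  qed
  also have "\<dots> = nrm T (lincomb n (lincomb d c (\<lambda>a i. U i a)) Y)"
    unfolding nrm_lincomb_Y
  proof (intro nrm_cong)
    fix a assume "a < d"
    from ip_orthonormal_lincomb[OF U_sys this, of c]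
    show "sqrt (lamS a) * c a = sqrt (lamS a) * (\<Sum>i<n. lincomb d c (\<lambda>a i. U i a) i * U i a)"
      by (simp add: ip_def mult.commute)
  qed
  finally show ?thesis .
qed

end

section \<open>Deterministic perturbation of the embedding\<close>

locale noisy_rows = signal_rows +
  fixes W :: "nat \<Rightarrow> nat \<Rightarrow> real" and p w :: real
  assumes p_nonneg: "0 \<le> p" and w_nonneg: "0 \<le> w"
    and W_op: "\<And>x. nrm T (lincomb n x W) \<le> w * nrm n x"
    and W_proj: "\<And>i. i < n \<Longrightarrow> nrm d (\<lambda>a. ip T (V a) (W i)) \<le> p"
    and small_row: "2 * p + w\<^sup>2 \<le> 1 / 2"
    and small_scale: "(2 * p + w\<^sup>2) * sqrt (lamS 0) \<le> sqrt (lamS (d - 1)) / 4"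
    and small_w: "2 * w \<le> sqrt (lamS (d - 1)) / 4"
begin

definition D :: "nat \<Rightarrow> real" where
  "D i = 1 / nrm T (\<lambda>t. Y i t + W i t)"

definition Yh :: "nat \<Rightarrow> nat \<Rightarrow> real" where
  "Yh i t = D i * (Y i t + W i t)"

lemma nrm_W:
  assumes "i < n" shows "nrm T (W i) \<le> w"
proof -
  let ?e = "\<lambda>j. if j = i then 1 else (0::real)"
  have "lincomb n ?e W t = (\<Sum>j<n. if j = i then W j t else 0)" for t
    unfolding lincomb_def by (intro sum.cong) auto
  then have "lincomb n ?e W = W i" using assms by (intro ext) simp
  moreover have "(\<Sum>j<n. (?e j)\<^sup>2) = (\<Sum>j<n. if j = i then 1 else 0)"
    by (intro sum.cong) auto
  then have "nrm n ?e = 1" using assms by (simp add: nrm_def)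
  ultimately show ?thesis using W_op[of ?e] by simp
qed

text \<open>The rows of \<open>Y\<close> lie in the span of \<open>V\<close>, so the cross term sees
  only the projected noise and costs \<open>p\<close>; the spectral norm \<open>w\<close> enters
  quadratically.\<close>

lemma row_norm_sq_close:
  assumes "i < n"
  shows "\<bar>(nrm T (\<lambda>t. Y i t + W i t))\<^sup>2 - 1\<bar> \<le> 2 * p + w\<^sup>2"
proof -
  have "(nrm T (\<lambda>t. Y i t + W i t))\<^sup>2 = 1 + 2 * ip T (Y i) (W i) + (nrm T (W i))\<^sup>2"
    unfolding ip_self[symmetric] ip_add_left ip_add_right ip_commute[of T "W i" "Y i"]
    using Y_unit[OF assms] by (simp add: ip_self)
  moreover have "ip T (Y i) (W i) = ip d (X i) (\<lambda>a. ip T (V a) (W i))"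
  proof -
    have "ip T (Y i) (W i) = ip T (lincomb d (X i) V) (W i)"
      by (intro ip_cong Y_expand[OF assms] refl)
    then show ?thesis by (simp add: ip_lincomb_left ip_def[of d])
  qed
  then have "\<bar>ip T (Y i) (W i)\<bar> \<le> p"
    using abs_ip_le[of d "X i" "\<lambda>a. ip T (V a) (W i)"] nrm_X[OF assms] W_proj[OF assms] by simp
  moreover have "(nrm T (W i))\<^sup>2 \<le> w\<^sup>2" by (intro power_mono nrm_W assms) simp
  moreover have "(nrm T (W i))\<^sup>2 \<ge> 0" by simp
  ultimately show ?thesis by linarith
qed

lemma D_bounds:
  assumes "i < n"
  shows "nrm T (\<lambda>t. Y i t + W i t) > 0" "\<bar>D i\<bar> \<le> 2" "\<bar>D i - 1\<bar> \<le> 2 * p + w\<^sup>2"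
proof -
  define s where "s = nrm T (\<lambda>t. Y i t + W i t)"
  have s2: "\<bar>s\<^sup>2 - 1\<bar> \<le> 2 * p + w\<^sup>2" unfolding s_def by (rule row_norm_sq_close[OF assms])
  have s2': "s\<^sup>2 \<ge> 1/2" using s2 small_row by linarith
  have s0: "s \<ge> 0" by (simp add: s_def)
  \<comment> \<open>(7/10)^2 = 49/100 lies below 1/2.\<close>
  have s: "s \<ge> 7/10"
    by (rule power2_le_imp_le) (use s2' s0 in \<open>auto simp: power2_eq_square\<close>)
  show "nrm T (\<lambda>t. Y i t + W i t) > 0" using s by (simp add: s_def)
  have Ds: "D i = 1 / s" by (simp add: D_def s_def)
  show "\<bar>D i\<bar> \<le> 2" using s by (simp add: Ds field_simps)
  \<comment> \<open>7/10 * 17/10 exceeds 1, so the denominator of D i - 1 = (1 - s^2) / (s (1 + s))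
    may be replaced by 1.\<close>
  have "s * (1 + s) \<ge> 7/10 * (1 + 7/10)" using s by (intro mult_mono) auto
  then have s1: "s * (1 + s) \<ge> 1" by simp
  have "D i - 1 = (1 - s\<^sup>2) / (s * (1 + s))"
  proof -
    have "1 - s\<^sup>2 = (1 - s) * (1 + s)" by (simp add: algebra_simps power2_eq_square)
    moreover have "1 + s \<noteq> 0" using s by linarith
    ultimately have "(1 - s\<^sup>2) / (s * (1 + s)) = (1 - s) / s" by simp
    then show ?thesis using s by (simp add: Ds diff_divide_distrib)
  qed
  then have "\<bar>D i - 1\<bar> = \<bar>s\<^sup>2 - 1\<bar> / (s * (1 + s))"
    using s by (simp add: abs_mult abs_minus_commute)
  also have "\<dots> \<le> \<bar>s\<^sup>2 - 1\<bar> / 1" using s1 by (intro divide_left_mono) auto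
  finally show "\<bar>D i - 1\<bar> \<le> 2 * p + w\<^sup>2" using s2 by simp
qed

text \<open>\<open>Yh\<close> differs from \<open>Y\<close> by (D - I) Y + D W. By
  \<open>small_scale\<close> and \<open>small_w\<close> each part costs at most a quarter of the
  smallest singular value of the signal, so half of it survives.\<close>

lemma nrm_lincomb_Yh:
  "nrm T (lincomb n (lincomb d c (\<lambda>a i. U i a)) Yh) \<ge> sqrt (lamS (d - 1)) / 2 * nrm d c"
proof -
  define x where "x = lincomb d c (\<lambda>a i. U i a)"
  have nx: "nrm n x = nrm d c" unfolding x_def by (rule nrm_orthonormal_lincomb[OF U_sys])
  let ?u = "lincomb n (\<lambda>i. (D i - 1) * x i) Y"
  let ?v = "lincomb n (\<lambda>i. D i * x i) W"
  have "lincomb n x Y t = lincomb n x Yh t - (?u t + ?v t)" for t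
    unfolding lincomb_def sum_subtractf[symmetric] sum.distrib[symmetric]
    by (intro sum.cong) (auto simp: Yh_def algebra_simps)
  then have "nrm T (lincomb n x Y) = nrm T (\<lambda>t. lincomb n x Yh t - (?u t + ?v t))"
    by (intro nrm_cong)
  also have "\<dots> \<le> nrm T (lincomb n x Yh) + (nrm T ?u + nrm T ?v)"
    using nrm_diff[of T "lincomb n x Yh" "\<lambda>t. ?u t + ?v t"] nrm_add[of T ?u ?v] by linarith
  finally have 1: "nrm T (lincomb n x Y) \<le> nrm T (lincomb n x Yh) + (nrm T ?u + nrm T ?v)" .
  have "nrm T ?u \<le> sqrt (lamS 0) * nrm n (\<lambda>i. (D i - 1) * x i)" by (rule nrm_lincomb_Y_upper)
  also have "\<dots> \<le> sqrt (lamS 0) * ((2 * p + w\<^sup>2) * nrm n x)"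
    using lam_pos[OF d_pos] D_bounds(3) by (intro mult_left_mono nrm_mult_le) auto
  also have "\<dots> \<le> sqrt (lamS (d - 1)) / 4 * nrm n x"
    using mult_right_mono[OF small_scale nrm_nonneg[of n x]] by (simp add: mult_ac)
  finally have 2: "nrm T ?u \<le> sqrt (lamS (d - 1)) / 4 * nrm n x" .
  have "nrm T ?v \<le> w * nrm n (\<lambda>i. D i * x i)" by (rule W_op)
  also have "\<dots> \<le> w * (2 * nrm n x)"
    using w_nonneg D_bounds(2) by (intro mult_left_mono nrm_mult_le) auto
  also have "\<dots> \<le> sqrt (lamS (d - 1)) / 4 * nrm n x"
    using mult_right_mono[OF small_w nrm_nonneg[of n x]] by (simp add: mult_ac)
  finally have 3: "nrm T ?v \<le> sqrt (lamS (d - 1)) / 4 * nrm n x" .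
  from 1 2 3 nrm_lincomb_Y_lower[of c] nx show ?thesis unfolding x_def[symmetric] by (simp add: field_simps)
qed

text \<open>Courant--Fischer: a vector of the signal space orthogonal to the first \<open>d - 1\<close> empirical
  eigenvectors has large quadratic form, which the \<open>d\<close>-th empirical eigenvalue dominates.\<close>
lemma eigenvalue_lower:
  assumes top: "top_eigenpairs n d A Uh lam"
    and A: "\<And>i j. i < n \<Longrightarrow> j < n \<Longrightarrow> A i j = ip T (Yh i) (Yh j)"
  shows "lam (d - 1) \<ge> lamS (d - 1) / 4"
proof -
  obtain e where e: "d = Suc e" using d_pos by (cases d) auto
  define B where "B = (\<lambda>a b. \<Sum>i<n. U i a * Uh i b)"
  \<comment> \<open>There are d coefficients against only \<open>e\<close>, that is d - 1,
    orthogonality conditions.\<close>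
  obtain c where c: "\<exists>a<d. c a \<noteq> 0" "\<And>b. b < e \<Longrightarrow> (\<Sum>a<d. c a * B a b) = 0"
    using exists_nontrivial_solution[of e B] unfolding e by blast
  define x where "x = lincomb d c (\<lambda>a i. U i a)"
  have nx: "nrm n x = nrm d c" unfolding x_def by (rule nrm_orthonormal_lincomb[OF U_sys])
  have "nrm d c \<noteq> 0" using c(1) by (simp add: nrm_eq_0)
  then have npos: "nrm d c > 0" using nrm_nonneg[of d c] by linarith
  have Uh: "(\<Sum>i<n. Uh i a * Uh i b) = (if a = b then 1 else 0)" if "a < d" "b < d" for a b
    using top that by (simp add: top_eigenpairs_def orthonormal_cols_def)
  have eig: "ip n (A i) (\<lambda>j. Uh j a) = lam a * Uh i a" if "a < d" "i < n" for a i
    using top that by (simp add: top_eigenpairs_def ip_def)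
  have sym: "A i j = A j i" if "i < n" "j < n" for i j
    using that by (simp add: A ip_commute)
  define q where "q = (\<lambda>x y. ip n x (\<lambda>i. ip n (A i) y))"
  have q_nrm: "q y y = (nrm T (lincomb n y Yh))\<^sup>2" for y
  proof -
    have "(nrm T (lincomb n y Yh))\<^sup>2 = (\<Sum>i<n. y i * (\<Sum>j<n. y j * ip T (Yh i) (Yh j)))"
      unfolding ip_self[symmetric] ip_lincomb_left by (simp add: ip_lincomb_right)
    then show ?thesis by (simp add: q_def ip_def[of n] A mult.commute)
  qed
  have qU: "q y (\<lambda>j. Uh j e) = lam e * ip n y (\<lambda>j. Uh j e)" for y
  proof -
    have "q y (\<lambda>j. Uh j e) = ip n y (\<lambda>i. lam e * Uh i e)"
      unfolding q_def using eig[of e] e by (intro ip_cong) auto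
    then show ?thesis by (simp add: ip_scale_right)
  qed
  have q_sym: "q y z = q z y" for y z
    unfolding q_def ip_def sum_distrib_left
    by (subst sum.swap) (auto intro!: sum.cong simp: sym)
  define \<alpha> where "\<alpha> = ip n x (\<lambda>j. Uh j e)"
  \<comment> \<open>Removing the component along the last eigenvector makes \<open>v\<close>
    orthogonal to all d of them, so the Rayleigh bound applies to \<open>v\<close>; the removed part
    contributes \<open>\<alpha>\<^sup>2 * lam e\<close>.\<close>
  define v where "v = (\<lambda>i. x i - \<alpha> * Uh i e)"
  have xU: "(\<Sum>i<n. x i * Uh i b) = (\<Sum>a<d. c a * B a b)" for b
    using ip_lincomb_left[of n d c "\<lambda>a i. U i a" "\<lambda>i. Uh i b"] by (simp add: x_def B_def ip_def)
  have v_orth: "(\<Sum>i<n. v i * Uh i b) = 0" if "b < d" for b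
  proof -
    have "(\<Sum>i<n. v i * Uh i b) = (\<Sum>i<n. x i * Uh i b) - \<alpha> * (\<Sum>i<n. Uh i e * Uh i b)"
      by (simp add: v_def left_diff_distrib sum_subtractf sum_distrib_left mult.assoc)
    also have "\<dots> = 0"
    proof (cases "b = e")
      case True
      then show ?thesis using Uh[of e e] e by (simp add: \<alpha>_def ip_def)
    next
      case False
      then have "b < e" using that e by simp
      then show ?thesis using Uh[of e b] False that e c(2) by (simp add: xU)
    qed
    finally show ?thesis .
  qed
  have x_eq: "x = (\<lambda>i. v i + \<alpha> * Uh i e)" by (simp add: v_def)
  have vU: "ip n v (\<lambda>j. Uh j e) = 0" using v_orth[of e] e by (simp add: ip_def)
  have UU: "ip n (\<lambda>j. Uh j e) (\<lambda>j. Uh j e) = 1" using Uh[of e e] e by (simp add: ip_def)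
  have "q x x = q v v + 2 * \<alpha> * q v (\<lambda>j. Uh j e) + \<alpha>\<^sup>2 * q (\<lambda>j. Uh j e) (\<lambda>j. Uh j e)"
    using q_sym[of v "\<lambda>j. Uh j e"] unfolding x_eq
    by (simp add: q_def ip_add_left ip_add_right ip_scale_left ip_scale_right power2_eq_square algebra_simps)
  also have "\<dots> = q v v + \<alpha>\<^sup>2 * lam e" by (simp add: qU vU UU)
  also have "q v v \<le> lam e * (nrm n v)\<^sup>2"
    using top_eigenpairs_rayleigh[OF top sym v_orth] e by (simp add: q_def)
  finally have "q x x \<le> lam e * ((nrm n v)\<^sup>2 + \<alpha>\<^sup>2)" by (simp add: algebra_simps)
  also have "(nrm n v)\<^sup>2 + \<alpha>\<^sup>2 = (nrm n x)\<^sup>2"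
    unfolding ip_self[symmetric] x_eq
    by (simp add: ip_add_left ip_add_right ip_scale_left ip_scale_right vU UU ip_commute[of n "\<lambda>j. Uh j e" v] power2_eq_square)
  finally have up: "(nrm T (lincomb n x Yh))\<^sup>2 \<le> lam e * (nrm d c)\<^sup>2" by (simp add: q_nrm nx)
  have "(sqrt (lamS (d - 1)) / 2 * nrm d c)\<^sup>2 \<le> (nrm T (lincomb n x Yh))\<^sup>2"
    using nrm_lincomb_Yh[of c] lam_pos[of "d - 1"] d_pos by (intro power_mono) (auto simp: x_def)
  also note up
  finally have "lamS (d - 1) / 4 * (nrm d c)\<^sup>2 \<le> lam e * (nrm d c)\<^sup>2"
    using lam_pos[of "d - 1"] d_pos by (simp add: power_mult_distrib power_divide)
  then show ?thesis using npos e by simp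
qed

text \<open>Origin of the constants: projected noise and D - I give 2 p each, and D - I gives one
  w^2 as well. With g = 4 w / sqrt l, the terms 2 g w and 2 g^2 account for 8 / sqrt l and 32 /
  l.\<close>

theorem embedding_perturbation:
  assumes top: "top_eigenpairs n d A Uh lam"
    and A: "\<And>i j. i < n \<Longrightarrow> j < n \<Longrightarrow> A i j = ip T (Yh i) (Yh j)"
  obtains Q where "Q \<in> orth_mats d"
    "\<And>i. i < n \<Longrightarrow> nrm d (\<lambda>b. embed Uh lam i b - matmul d X Q i b)
        \<le> 4 * p + w\<^sup>2 * (1 + 8 / sqrt (lamS (d - 1)) + 32 / lamS (d - 1))"
proof -
  define l where "l = lamS (d - 1)"
  have l: "l > 0" using lam_pos[of "d - 1"] d_pos by (simp add: l_def)
  \<comment> \<open>Positive empirical eigenvalues allow the empirical right singular vectors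
    \<open>Vh\<close> to be defined by division.\<close>
  have lam_ge: "lam a \<ge> l / 4" if "a < d" for a
  proof -
    have "lam (d - 1) \<le> lam a" using top that unfolding top_eigenpairs_def by auto
    then show ?thesis using eigenvalue_lower[OF top A] by (simp add: l_def)
  qed
  have lamh_pos: "lam a > 0" if "a < d" for a using lam_ge[OF that] l by linarith
  have Uh: "(\<Sum>i<n. Uh i a * Uh i b) = (if a = b then 1 else 0)" if "a < d" "b < d" for a b
    using top that by (simp add: top_eigenpairs_def orthonormal_cols_def)
  have Uh_sys: "orthonormal_sys n d (\<lambda>a i. Uh i a)"
    using Uh by (simp add: orthonormal_sys_def ip_def)
  have eig: "(\<Sum>j<n. A i j * Uh j a) = lam a * Uh i a" if "a < d" "i < n" for a i
    using top that by (simp add: top_eigenpairs_def)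
  define Xh where "Xh = embed Uh lam"
  define Vh where "Vh = (\<lambda>b. lincomb n (\<lambda>j. Uh j b / sqrt (lam b)) Yh)"
  have Vh_Yh: "ip T (Vh b) (Yh i) = Xh i b" if "b < d" "i < n" for b i
  proof -
    have "ip T (Vh b) (Yh i) = (\<Sum>j<n. A i j * Uh j b) / sqrt (lam b)"
      unfolding Vh_def ip_lincomb_left sum_divide_distrib
      using that by (intro sum.cong) (auto simp: A ip_commute[of T "Yh i"])
    also have "\<dots> = lam b / sqrt (lam b) * Uh i b" by (simp add: eig that)
    finally show ?thesis using lamh_pos[OF that(1)] by (simp add: Xh_def embed_def real_div_sqrt)
  qed
  have Vh_orth: "orthonormal_sys T d Vh"
    unfolding orthonormal_sys_def
  proof (intro allI impI)
    fix a b assume ab: "a < d" "b < d"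
    have "ip T (Vh a) (Vh b) = (\<Sum>i<n. Uh i b / sqrt (lam b) * Xh i a)"
      by (subst (2) Vh_def) (simp add: ip_lincomb_right Vh_Yh ab)
    also have "\<dots> = (\<Sum>i<n. Uh i b * Uh i a) * (sqrt (lam a) / sqrt (lam b))"
      by (simp add: embed_def Xh_def sum_distrib_left sum_divide_distrib mult_ac)
    also have "\<dots> = (if a = b then 1 else 0)"
      using Uh[OF ab(2,1)] lamh_pos[OF ab(2)] by auto
    finally show "ip T (Vh a) (Vh b) = (if a = b then 1 else 0)" .
  qed
  define H where "H = (\<lambda>a b. ip T (V a) (Vh b))"
  define G where "G = (\<lambda>b t. Vh b t - lincomb d (\<lambda>a. H a b) V t)"
  \<comment> \<open>A factor 2 bounds \<open>D\<close>, and 2 / sqrt l bounds the inverse square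
    roots of the empirical eigenvalues.\<close>
  define g where "g = 4 * w / sqrt l"
  have g: "g \<ge> 0" using w_nonneg l by (simp add: g_def)
  \<comment> \<open>The combination of \<open>Vh\<close> equals Y^T qD + W^T qD, and the first part
    lies in the span of \<open>V\<close>. Since projection is the best approximation, the residual
    is at most |W^T qD|.\<close>
  have G_op: "nrm T (lincomb d c G) \<le> g * nrm d c" for c
  proof -
    define z where "z = lincomb d c Vh"
    define q where "q = lincomb d (\<lambda>b. 1 / sqrt (lam b) * c b) (\<lambda>b j. Uh j b)"
    define qD where "qD = (\<lambda>j. D j * q j)"
    define y where "y = (\<lambda>a. \<Sum>j<n. qD j * X j a)"
    have pz: "ip T (V a) z = (\<Sum>b<d. c b * H a b)" for a
      by (simp add: z_def ip_lincomb_right H_def)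
    have "lincomb d c G t = z t - lincomb d (\<lambda>a. ip T (V a) z) V t" for t
    proof -
      have "lincomb d c G t = z t - (\<Sum>b<d. \<Sum>a<d. c b * H a b * V a t)"
        by (simp add: lincomb_def G_def z_def right_diff_distrib sum_subtractf sum_distrib_left mult.assoc)
      also have "(\<Sum>b<d. \<Sum>a<d. c b * H a b * V a t) = lincomb d (\<lambda>a. ip T (V a) z) V t"
        unfolding pz lincomb_def sum_distrib_right by (rule sum.swap)
      finally show ?thesis .
    qed
    then have "nrm T (lincomb d c G) = nrm T (\<lambda>t. z t - lincomb d (\<lambda>a. ip T (V a) z) V t)"
      by (intro nrm_cong)
    also have "\<dots> \<le> nrm T (\<lambda>t. z t - lincomb d y V t)" by (rule nrm_residual_le[OF V_orth])
    also have "\<dots> = nrm T (lincomb n qD W)"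
    proof (intro nrm_cong)
      fix t assume t: "t < T"
      have "z t = (\<Sum>b<d. \<Sum>j<n. (c b * (Uh j b / sqrt (lam b))) * Yh j t)"
        by (simp add: z_def Vh_def lincomb_def sum_distrib_left mult.assoc)
      also have "\<dots> = (\<Sum>j<n. q j * Yh j t)"
        unfolding q_def lincomb_def sum_distrib_right by (subst sum.swap) (simp add: mult_ac)
      also have "\<dots> = lincomb n qD Y t + lincomb n qD W t"
        by (simp add: lincomb_def Yh_def qD_def sum.distrib[symmetric] algebra_simps)
      also have "lincomb n qD Y t = lincomb d y V t" unfolding y_def by (rule lincomb_Y[OF t])
      finally show "z t - lincomb d y V t = lincomb n qD W t" by simp
    qed
    also have "\<dots> \<le> w * nrm n qD" by (rule W_op)
    also have "\<dots> \<le> w * (2 * nrm n q)"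
      unfolding qD_def using w_nonneg D_bounds(2) by (intro mult_left_mono nrm_mult_le) auto
    also have "nrm n q = nrm d (\<lambda>b. 1 / sqrt (lam b) * c b)"
      unfolding q_def by (rule nrm_orthonormal_lincomb[OF Uh_sys])
    also have "w * (2 * nrm d (\<lambda>b. 1 / sqrt (lam b) * c b)) \<le> w * (2 * (2 / sqrt l * nrm d c))"
    proof -
      have "\<bar>1 / sqrt (lam b)\<bar> \<le> 2 / sqrt l" if "b < d" for b
      proof -
        have "sqrt (l / 4) \<le> sqrt (lam b)" using lam_ge[OF that] by simp
        then have "sqrt l / 2 \<le> sqrt (lam b)" by (simp add: real_sqrt_divide)
        moreover have "sqrt l > 0" "sqrt (lam b) > 0" using l lamh_pos[OF that] by auto
        ultimately show ?thesis by (simp add: field_simps)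
      qed
      then show ?thesis using w_nonneg by (intro mult_left_mono nrm_mult_le) auto
    qed
    also have "\<dots> = g * nrm d c" by (simp add: g_def)
    finally show ?thesis .
  qed
  have GV: "ip T (G b) (V a) = 0" if "a < d" for a b
    using ip_orthonormal_lincomb[OF V_orth that, of "\<lambda>a. H a b"]
    by (simp add: G_def ip_diff_left H_def ip_commute[of T _ "V a"])
  \<comment> \<open>Pythagoras: G^T G = I - H^T H, so H^T H differs from I by at most g^2, as
    \<open>polar_bound\<close> requires.\<close>
  have GG: "ip T (G b) (G c) = (if b = c then 1 else 0) - tmul d H H b c" if "b < d" "c < d" for b c
  proof -
    have "ip T (G b) (G c) = ip T (G b) (Vh c)"
      by (subst (2) G_def) (simp add: ip_diff_right ip_lincomb_right GV)
    also have "\<dots> = ip T (Vh b) (Vh c) - (\<Sum>a<d. H a b * H a c)"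
      by (simp add: G_def ip_diff_left ip_lincomb_left H_def)
    finally show ?thesis using Vh_orth that by (simp add: orthonormal_sys_def tmul_def)
  qed
  have HH: "nrm d (\<lambda>b. ip d (tmul d H H b) z - z b) \<le> g\<^sup>2 * nrm d z" for z
  proof -
    have "ip d (tmul d H H b) z - z b = -1 * ip T (G b) (lincomb d z G)" if "b < d" for b
    proof -
      have "ip T (G b) (lincomb d z G) = (\<Sum>c<d. (if c = b then z c else 0) - tmul d H H b c * z c)"
        unfolding ip_lincomb_right using that by (intro sum.cong) (auto simp: GG algebra_simps)
      then show ?thesis using that by (simp add: sum_subtractf ip_def)
    qed
    then have "nrm d (\<lambda>b. ip d (tmul d H H b) z - z b) = nrm d (\<lambda>b. -1 * ip T (G b) (lincomb d z G))"
      by (rule nrm_cong)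
    also have "\<dots> = nrm d (\<lambda>b. ip T (G b) (lincomb d z G))"
      using nrm_scale[of d "-1" "\<lambda>b. ip T (G b) (lincomb d z G)"] by simp
    also have "\<dots> \<le> g * nrm T (lincomb d z G)" by (rule nrm_adjoint[OF G_op g])
    also have "\<dots> \<le> g * (g * nrm d z)" by (intro mult_left_mono G_op g)
    finally show ?thesis by (simp add: power2_eq_square)
  qed
  obtain Q where Q: "Q \<in> orth_mats d"
    and Q_iso: "\<And>x. nrm d (\<lambda>b. \<Sum>a<d. x a * Q a b) = nrm d x"
    and Q_close: "\<And>x. nrm d (\<lambda>b. \<Sum>a<d. x a * (H a b - Q a b)) \<le> g\<^sup>2 * nrm d x"
    using polar_bound[OF HH] by blast
  have "nrm d (\<lambda>b. Xh i b - matmul d X Q i b)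
      \<le> 4 * p + w\<^sup>2 * (1 + 8 / sqrt l + 32 / l)" if i: "i < n" for i
  proof -
    define pw where "pw = (\<lambda>a. ip T (V a) (W i))"
    let ?t1 = "\<lambda>b. D i * ip T (Vh b) (lincomb d pw V)"
    let ?t2 = "\<lambda>b. D i * ip T (G b) (W i)"
    let ?t3 = "\<lambda>b. D i * (\<Sum>a<d. X i a * (H a b - Q a b))"
    let ?t4 = "\<lambda>b. (D i - 1) * (\<Sum>a<d. X i a * Q a b)"
    have eq: "Xh i b - matmul d X Q i b = ?t1 b + (?t2 b + (?t3 b + ?t4 b))" if b: "b < d" for b
    proof -
      have e1: "Xh i b = D i * (ip T (Vh b) (Y i) + ip T (Vh b) (W i))"
        using Vh_Yh[OF b i] by (simp add: Yh_def[abs_def] ip_scale_right ip_add_right)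
      have e2: "ip T (Vh b) (Y i) = (\<Sum>a<d. X i a * H a b)"
      proof -
        have "ip T (Vh b) (Y i) = ip T (Vh b) (lincomb d (X i) V)"
          by (intro ip_cong Y_expand[OF i] refl)
        then show ?thesis by (simp add: ip_lincomb_right H_def ip_commute[of T "Vh b"])
      qed
      have e3: "ip T (Vh b) (lincomb d pw V) = (\<Sum>a<d. pw a * H a b)"
        by (simp add: ip_lincomb_right H_def ip_commute[of T "Vh b"])
      have e4: "ip T (G b) (W i) = ip T (Vh b) (W i) - (\<Sum>a<d. pw a * H a b)"
        by (simp add: G_def ip_diff_left ip_lincomb_left pw_def mult.commute)
      have e5: "(\<Sum>a<d. X i a * (H a b - Q a b)) = (\<Sum>a<d. X i a * H a b) - (\<Sum>a<d. X i a * Q a b)"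
        by (simp add: right_diff_distrib sum_subtractf)
      have e6: "matmul d X Q i b = (\<Sum>a<d. X i a * Q a b)" by (simp add: matmul_def)
      show ?thesis unfolding e1 e2 e3 e4 e5 e6 by (simp add: algebra_simps)
    qed
    have D2: "\<bar>D i\<bar> \<le> 2" and D1: "\<bar>D i - 1\<bar> \<le> 2 * p + w\<^sup>2" using D_bounds[OF i] by auto
    have "nrm d ?t1 \<le> 2 * p"
    proof -
      have "nrm d (\<lambda>b. ip T (Vh b) (lincomb d pw V)) \<le> nrm T (lincomb d pw V)" by (rule bessel[OF Vh_orth])
      also have "\<dots> = nrm d pw" by (rule nrm_orthonormal_lincomb[OF V_orth])
      also have "\<dots> \<le> p" unfolding pw_def by (rule W_proj[OF i])
      finally show ?thesis unfolding nrm_scale using D2 by (intro mult_mono) auto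
    qed
    moreover have "nrm d ?t2 \<le> 2 * (g * w)"
    proof -
      have "nrm d (\<lambda>b. ip T (G b) (W i)) \<le> g * nrm T (W i)" by (rule nrm_adjoint[OF G_op g])
      also have "\<dots> \<le> g * w" by (intro mult_left_mono nrm_W i g)
      finally show ?thesis unfolding nrm_scale using D2 by (intro mult_mono) auto
    qed
    moreover have "nrm d ?t3 \<le> 2 * g\<^sup>2"
      unfolding nrm_scale using D2 Q_close[of "X i"] nrm_X[OF i] by (intro mult_mono) auto
    moreover have "nrm d ?t4 \<le> 2 * p + w\<^sup>2"
      unfolding nrm_scale Q_iso using D1 nrm_X[OF i] by simp
    moreover have "nrm d (\<lambda>b. Xh i b - matmul d X Q i b) \<le> nrm d ?t1 + (nrm d ?t2 + (nrm d ?t3 + nrm d ?t4))"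
    proof -
      have "nrm d (\<lambda>b. Xh i b - matmul d X Q i b) = nrm d (\<lambda>b. ?t1 b + (?t2 b + (?t3 b + ?t4 b)))"
        by (rule nrm_cong[OF eq])
      then show ?thesis
        using nrm_add[of d ?t1 "\<lambda>b. ?t2 b + (?t3 b + ?t4 b)"]
          nrm_add[of d ?t2 "\<lambda>b. ?t3 b + ?t4 b"] nrm_add[of d ?t3 ?t4] by linarith
    qed
    ultimately have "nrm d (\<lambda>b. Xh i b - matmul d X Q i b) \<le> 4 * p + (w\<^sup>2 + 2 * (g * w) + 2 * g\<^sup>2)"
      by linarith
    also have "w\<^sup>2 + 2 * (g * w) + 2 * g\<^sup>2 = w\<^sup>2 * (1 + 8 / sqrt l + 32 / l)"
      using l by (simp add: g_def power_divide power_mult_distrib algebra_simps power2_eq_square)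
    finally show ?thesis .
  qed
  then show ?thesis using that[OF Q] unfolding Xh_def l_def by blast
qed

end

section \<open>Nets and operator norms\<close>

text \<open>Integer points of the ball of radius 2 sqrt m. The coordinate range is implied by the
  norm bound and makes finiteness immediate.\<close>

definition int_ball :: "nat \<Rightarrow> (nat \<Rightarrow> int) set" where
  "int_ball m = {z \<in> PiE {..<m} (\<lambda>_. {- int (4 * m)..int (4 * m)}). (\<Sum>i<m. (real_of_int (z i))\<^sup>2) \<le> 4 * real m}"

text \<open>With mesh 1 / (2 sqrt m), coordinatewise rounding moves a vector by at most 1/2, while
  the number of points stays exponential in \<open>m\<close>.\<close>

definition net :: "nat \<Rightarrow> (nat \<Rightarrow> real) set" where
  "net m = (\<lambda>z i. real_of_int (z i) / (2 * sqrt (real m))) ` int_ball m"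

lemma finite_int_ball: "finite (int_ball m)"
  unfolding int_ball_def by (rule finite_subset[of _ "PiE {..<m} (\<lambda>_. {- int (4 * m)..int (4 * m)})"])
    (auto intro!: finite_PiE)

lemma finite_net: "finite (net m)"
  unfolding net_def by (intro finite_imageI finite_int_ball)

text \<open>For k >= 1, exp (-k^2) <= 2^(-k), a comparison with a geometric series; the explicit
  remainder closes the induction.\<close>

lemma sum_exp_neg_square_le: "(\<Sum>k\<in>{- int K..int K}. exp (- (real_of_int k)\<^sup>2)) \<le> 3 - 2 * (1/2) ^ K"
proof (induction K)
  case 0
  show ?case by simp
next
  case (Suc K)
  have "exp (- (real (Suc K))\<^sup>2) \<le> (1/2) ^ Suc K"
  proof -
    have "real (Suc K) \<le> (real (Suc K))\<^sup>2" by (simp add: power2_eq_square)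
    then have "exp (- (real (Suc K))\<^sup>2) \<le> exp (- real (Suc K))" by simp
    also have "\<dots> = exp (-1) ^ Suc K" by (simp only: exp_of_nat_mult[symmetric]) simp
    also have "\<dots> \<le> (1/2) ^ Suc K"
    proof (intro power_mono)
      have "exp (1::real) \<ge> 2" using exp_ge_add_one_self[of 1] by simp
      then show "exp (-1) \<le> (1/2 :: real)" by (simp add: exp_minus field_simps)
    qed auto
    finally show ?thesis .
  qed
  moreover have "{- int (Suc K)..int (Suc K)} = insert (- int (Suc K)) (insert (int (Suc K)) {- int K..int K})"
    by auto
  then have "(\<Sum>k\<in>{- int (Suc K)..int (Suc K)}. exp (- (real_of_int k)\<^sup>2))
      = 2 * exp (- (real (Suc K))\<^sup>2) + (\<Sum>k\<in>{- int K..int K}. exp (- (real_of_int k)\<^sup>2))"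
    by (simp add: add.commute power2_eq_square algebra_simps)
  ultimately have "(\<Sum>k\<in>{- int (Suc K)..int (Suc K)}. exp (- (real_of_int k)\<^sup>2))
      \<le> 2 * (1/2) ^ Suc K + (3 - 2 * (1/2) ^ K)" using Suc by linarith
  then show ?case by simp
qed

text \<open>Lattice points in a ball are counted by an exponential moment:
  \<open>1 \<le> exp (4 m - |z|\<^sup>2)\<close> on the ball, and the Gaussian sum over the lattice factorises.\<close>
lemma card_net_le: "real (card (net m)) \<le> exp (6 * real m)"
proof -
  let ?P = "PiE {..<m} (\<lambda>_. {- int (4 * m)..int (4 * m)})"
  have "real (card (net m)) \<le> real (card (int_ball m))"
    unfolding net_def using card_image_le[OF finite_int_ball] by simp
  also have "\<dots> = (\<Sum>z\<in>int_ball m. 1)" by simp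
  also have "\<dots> \<le> (\<Sum>z\<in>int_ball m. exp (4 * real m) * (\<Prod>i<m. exp (- (real_of_int (z i))\<^sup>2)))"
  proof (rule sum_mono)
    fix z assume "z \<in> int_ball m"
    then have "0 \<le> 4 * real m + (\<Sum>i<m. - (real_of_int (z i))\<^sup>2)"
      by (simp add: int_ball_def sum_negf)
    then have "1 \<le> exp (4 * real m + (\<Sum>i<m. - (real_of_int (z i))\<^sup>2))" by simp
    then show "1 \<le> exp (4 * real m) * (\<Prod>i<m. exp (- (real_of_int (z i))\<^sup>2))"
      by (simp add: exp_add exp_sum)
  qed
  also have "\<dots> \<le> (\<Sum>z\<in>?P. exp (4 * real m) * (\<Prod>i<m. exp (- (real_of_int (z i))\<^sup>2)))"
  proof (rule sum_mono2)
    show "finite ?P" by (intro finite_PiE) auto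
    show "int_ball m \<subseteq> ?P" by (simp only: int_ball_def) blast
  qed (simp add: prod_nonneg)
  also have "\<dots> = exp (4 * real m) * (\<Prod>i<m. \<Sum>k\<in>{- int (4 * m)..int (4 * m)}. exp (- (real_of_int k)\<^sup>2))"
    by (subst prod_sum_PiE) (auto simp: sum_distrib_left)
  \<comment> \<open>Each factor is at most 3 <= exp 2, which raises the exponent from 4 to
    6.\<close>
  also have "\<dots> \<le> exp (4 * real m) * (\<Prod>i<m. exp 2)"
  proof (intro mult_left_mono prod_mono conjI sum_nonneg)
    have "exp (2::real) \<ge> 3" using exp_ge_add_one_self[of 2] by simp
    moreover have "(\<Sum>k\<in>{- int (4 * m)..int (4 * m)}. exp (- (real_of_int k)\<^sup>2)) \<le> 3 - 2 * (1/2) ^ (4 * m)"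
      by (rule sum_exp_neg_square_le)
    moreover have "(1/2 :: real) ^ (4 * m) \<ge> 0" by simp
    ultimately show "(\<Sum>k\<in>{- int (4 * m)..int (4 * m)}. exp (- (real_of_int k)\<^sup>2)) \<le> exp 2" by linarith
  qed auto
  also have "\<dots> = exp (4 * real m) * exp (real m * 2)" by (simp add: exp_of_nat_mult)
  also have "\<dots> = exp (6 * real m)" unfolding exp_add[symmetric] by (simp add: algebra_simps)
  finally show ?thesis .
qed

lemma nrm_net_le:
  assumes "u \<in> net m"
  shows "nrm m u \<le> 1"
proof (cases "m = 0")
  case False
  obtain z where z: "z \<in> int_ball m" "u = (\<lambda>i. real_of_int (z i) / (2 * sqrt (real m)))"
    using assms by (auto simp: net_def)
  have "(\<Sum>i<m. (u i)\<^sup>2) = (\<Sum>i<m. (real_of_int (z i))\<^sup>2) / (4 * real m)"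
    by (simp add: z(2) power_divide power_mult_distrib sum_divide_distrib)
  also have "\<dots> \<le> 1" using z(1) False by (simp add: int_ball_def divide_le_eq)
  finally show ?thesis by (simp add: nrm_def)
qed (simp add: nrm_def)

text \<open>Truncating \<open>2 sqrt m x\<close> towards zero does not increase the norm.\<close>
lemma net_approx:
  assumes x: "nrm m x \<le> 1"
  obtains u where "u \<in> net m" "nrm m (\<lambda>i. x i - u i) \<le> 1 / 2"
proof (cases "m = 0")
  case True
  \<comment> \<open>For m = 0 the only extensional function is \<open>undefined\<close> everywhere;
    it represents the empty vector.\<close>
  then have "(\<lambda>_. undefined) \<in> int_ball m" by (simp add: int_ball_def PiE_def extensional_def fun_eq_iff)
  then have "(\<lambda>i. real_of_int undefined / (2 * sqrt (real m))) \<in> net m"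
    unfolding net_def by (rule rev_image_eqI) simp
  then show ?thesis using that True by (simp add: nrm_def)
next
  case False
  define s where "s = 2 * sqrt (real m)"
  have s: "s > 0" "s\<^sup>2 = 4 * real m" using False by (auto simp: s_def power_mult_distrib)
  define tr where "tr = (\<lambda>y::real. if y \<ge> 0 then \<lfloor>y\<rfloor> else \<lceil>y\<rceil>)"
  have tr1: "\<bar>real_of_int (tr y)\<bar> \<le> \<bar>y\<bar>" for y unfolding tr_def by (auto; linarith)
  have tr2: "\<bar>y - real_of_int (tr y)\<bar> \<le> 1" for y unfolding tr_def by (auto; linarith)
  define z where "z = restrict (\<lambda>i. tr (s * x i)) {..<m}"
  define u where "u = (\<lambda>i. real_of_int (z i) / s)"
  have zi: "z i = tr (s * x i)" if "i < m" for i using that by (simp add: z_def)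
  have x2: "(\<Sum>i<m. (x i)\<^sup>2) \<le> 1" using x by (simp add: nrm_def)
  have "(\<Sum>i<m. (real_of_int (z i))\<^sup>2) \<le> (\<Sum>i<m. (s * x i)\<^sup>2)"
    using tr1 by (intro sum_mono) (auto simp: zi abs_le_square_iff[symmetric])
  also have "\<dots> = 4 * real m * (\<Sum>i<m. (x i)\<^sup>2)"
    by (simp add: power_mult_distrib s(2) sum_distrib_left)
  also have "\<dots> \<le> 4 * real m" using x2 mult_left_mono[OF x2, of "4 * real m"] by simp
  finally have z2: "(\<Sum>i<m. (real_of_int (z i))\<^sup>2) \<le> 4 * real m" .
  have "z i \<in> {- int (4 * m)..int (4 * m)}" if "i < m" for i
  proof -
    have "(real_of_int (z i))\<^sup>2 \<le> (\<Sum>i<m. (real_of_int (z i))\<^sup>2)"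
      using that by (intro member_le_sum) auto
    with z2 have "(real_of_int (z i))\<^sup>2 \<le> 4 * real m" by linarith
    then have "real_of_int ((z i)\<^sup>2) \<le> real_of_int (4 * int m)" by simp
    then have "(z i)\<^sup>2 \<le> 4 * int m" by (simp only: of_int_le_iff)
    moreover have "\<bar>z i\<bar> \<le> (z i)\<^sup>2"
      using mult_left_mono[of 1 "\<bar>z i\<bar>" "\<bar>z i\<bar>"] by (cases "z i = 0") (auto simp: power2_eq_square abs_mult_self_eq)
    ultimately show ?thesis by auto
  qed
  then have "z \<in> int_ball m" using z2 by (simp add: int_ball_def z_def)
  then have "u \<in> net m" unfolding net_def u_def s_def by blast
  moreover have "nrm m (\<lambda>i. x i - u i) \<le> 1 / 2"
  proof -
    have "(x i - u i)\<^sup>2 \<le> 1 / s\<^sup>2" if "i < m" for i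
    proof -
      have "x i - u i = (s * x i - real_of_int (tr (s * x i))) / s"
        using s by (simp add: u_def zi that field_simps)
      moreover have "(s * x i - real_of_int (tr (s * x i)))\<^sup>2 \<le> 1\<^sup>2"
        unfolding abs_le_square_iff[symmetric] using tr2 by simp
      ultimately show ?thesis by (simp add: power_divide divide_right_mono)
    qed
    then have "(\<Sum>i<m. (x i - u i)\<^sup>2) \<le> (\<Sum>i<m. 1 / s\<^sup>2)" by (intro sum_mono) auto
    also have "\<dots> = (1/2)\<^sup>2" using False unfolding s(2) by (simp add: power2_eq_square)
    finally show ?thesis unfolding nrm_def by (intro real_le_lsqrt) auto
  qed
  ultimately show ?thesis by (rule that)
qed

text \<open>A vector of the ball is u + y / 2 with \<open>u\<close> in the net and \<open>y\<close>
  again in the ball. Iteration halves the crude bound \<open>F\<close> each time and leaves K + K/2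
  + ... = 2 K.\<close>

lemma seminorm_le_net:
  fixes f :: "(nat \<Rightarrow> real) \<Rightarrow> real"
  assumes add: "\<And>x y. f (\<lambda>i. x i + y i) \<le> f x + f y"
    and scale: "\<And>c x. f (\<lambda>i. c * x i) = \<bar>c\<bar> * f x"
    and F: "\<And>x. f x \<le> F * nrm m x"
    and F0: "0 \<le> F" and K0: "0 \<le> K"
    and K: "\<And>u. u \<in> net m \<Longrightarrow> f u \<le> K"
  shows "f x \<le> 2 * K * nrm m x"
proof -
  have ball: "f x \<le> 2 * K + F / 2 ^ k" if "nrm m x \<le> 1" for x k
    using that
  proof (induction k arbitrary: x)
    case 0
    then show ?case using F[of x] mult_left_mono[OF 0, of F] F0 K0 by simp
  next
    case (Suc k)
    obtain u where u: "u \<in> net m" "nrm m (\<lambda>i. x i - u i) \<le> 1 / 2" using net_approx[OF Suc.prems] by blast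
    define y where "y = (\<lambda>i. 2 * (x i - u i))"
    have "nrm m y \<le> 1" unfolding y_def nrm_scale using u(2) by simp
    then have IH: "f y \<le> 2 * K + F / 2 ^ k" by (rule Suc.IH)
    have "x = (\<lambda>i. u i + (1 / 2) * y i)" by (simp add: y_def fun_eq_iff field_simps)
    then have "f x \<le> f u + f (\<lambda>i. (1 / 2) * y i)" using add by metis
    also have "f (\<lambda>i. (1 / 2) * y i) = \<bar>1 / 2\<bar> * f y" by (rule scale)
    finally have "f x \<le> f u + 1 / 2 * f y" by simp
    then show ?case using K[OF u(1)] IH by simp
  qed
  show ?thesis
  proof (cases "nrm m x = 0")
    case True
    then show ?thesis using F[of x] by simp
  next
    case False
    then have pos: "nrm m x > 0" using nrm_nonneg[of m x] by linarith
    define y where "y = (\<lambda>i. (1 / nrm m x) * x i)"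
    have "nrm m y \<le> 1" unfolding y_def nrm_scale using pos by simp
    then have "f y \<le> 2 * K + F / 2 ^ k" for k by (rule ball)
    moreover have "(\<lambda>k. 2 * K + F / 2 ^ k) \<longlonglongrightarrow> 2 * K + 0"
      by (intro tendsto_intros LIMSEQ_divide_realpow_zero) simp
    ultimately have "f y \<le> 2 * K" by (intro LIMSEQ_le_const[of _ "2 * K"]) auto
    moreover have "f y = 1 / nrm m x * f x" unfolding y_def scale using pos by simp
    ultimately show ?thesis using pos by (simp add: field_simps)
  qed
qed


text \<open>The passage from net to ball is made twice, once for the dual vector \<open>v\<close>
  and once for \<open>u\<close>, at a factor 2 each.\<close>

lemma nrm_lincomb_le_net:
  assumes K: "\<And>u v. u \<in> net n \<Longrightarrow> v \<in> net T \<Longrightarrow> \<bar>ip T v (lincomb n u B)\<bar> \<le> K" and K0: "0 \<le> K"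
  shows "nrm T (lincomb n x B) \<le> 4 * K * nrm n x"
proof -
  have inner: "nrm T y \<le> 2 * K'" if K': "\<And>v. v \<in> net T \<Longrightarrow> \<bar>ip T v y\<bar> \<le> K'" "0 \<le> K'" for y K'
  proof -
    \<comment> \<open>The seminorm given by pairing with \<open>y\<close> is evaluated at
      \<open>y\<close> itself.\<close>
    have "\<bar>ip T y y\<bar> \<le> 2 * K' * nrm T y"
    proof (rule seminorm_le_net[where f = "\<lambda>v. \<bar>ip T v y\<bar>" and F = "nrm T y"])
      show "\<bar>ip T x y\<bar> \<le> nrm T y * nrm T x" for x using abs_ip_le[of T x y] by (simp add: mult.commute)
    qed (use K' in \<open>auto simp: ip_add_left ip_scale_left abs_mult\<close>)
    then have "(nrm T y)\<^sup>2 \<le> 2 * K' * nrm T y" by (simp add: ip_self)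
    then show ?thesis using K'(2) by (intro nrm_le_of_sq) auto
  qed
  have "nrm T (lincomb n x B) \<le> 2 * (2 * K) * nrm n x"
  proof (rule seminorm_le_net[where f = "\<lambda>x. nrm T (lincomb n x B)" and F = "\<Sum>i<n. nrm T (B i)"])
    show "nrm T (lincomb n (\<lambda>i. x i + y i) B) \<le> nrm T (lincomb n x B) + nrm T (lincomb n y B)" for x y
      using nrm_add[of T "lincomb n x B" "lincomb n y B"]
      by (simp add: lincomb_def[abs_def] distrib_right sum.distrib)
    show "nrm T (lincomb n (\<lambda>i. c * x i) B) = \<bar>c\<bar> * nrm T (lincomb n x B)" for c x
      using nrm_scale[of T c "lincomb n x B"]
      by (simp add: lincomb_def[abs_def] sum_distrib_left mult.assoc)
    show "nrm T (lincomb n x B) \<le> (\<Sum>i<n. nrm T (B i)) * nrm n x" for x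
    proof (rule nrm_le_of_sq)
      have "(nrm T (lincomb n x B))\<^sup>2 = (\<Sum>i<n. x i * ip T (B i) (lincomb n x B))"
        unfolding ip_self[symmetric] by (rule ip_lincomb_left)
      also have "\<dots> \<le> (\<Sum>i<n. nrm n x * (nrm T (B i) * nrm T (lincomb n x B)))"
      proof (intro sum_mono)
        fix i assume "i \<in> {..<n}"
        then have "\<bar>x i\<bar> * \<bar>ip T (B i) (lincomb n x B)\<bar> \<le> nrm n x * (nrm T (B i) * nrm T (lincomb n x B))"
          by (intro mult_mono abs_le_nrm abs_ip_le) auto
        then show "x i * ip T (B i) (lincomb n x B) \<le> nrm n x * (nrm T (B i) * nrm T (lincomb n x B))"
          by (metis abs_ge_self abs_mult order_trans)
      qed
      also have "\<dots> = (\<Sum>i<n. nrm T (B i)) * nrm n x * nrm T (lincomb n x B)"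
        by (simp add: sum_distrib_left sum_distrib_right mult_ac)
      finally show "(nrm T (lincomb n x B))\<^sup>2 \<le> (\<Sum>i<n. nrm T (B i)) * nrm n x * nrm T (lincomb n x B)" .
    qed (simp add: sum_nonneg)
    show "nrm T (lincomb n u B) \<le> 2 * K" if "u \<in> net n" for u
      using that K K0 by (intro inner) auto
  qed (use K0 in \<open>auto intro: sum_nonneg\<close>)
  then show ?thesis by simp
qed

section \<open>Subgaussian tails\<close>

lemma subgaussian_mono:
  assumes "subgaussian M X \<nu>" "\<nu> \<le> \<nu>'"
  shows "subgaussian M X \<nu>'"
  unfolding subgaussian_def
proof (intro conjI allI)
  fix l :: real
  have "(\<integral>\<omega>. exp (l * X \<omega>) \<partial>M) \<le> exp (l\<^sup>2 * \<nu> / 2)" using assms by (simp add: subgaussian_def)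
  also have "\<dots> \<le> exp (l\<^sup>2 * \<nu>' / 2)" using assms(2) by (simp add: mult_left_mono)
  finally show "(\<integral>\<omega>. exp (l * X \<omega>) \<partial>M) \<le> exp (l\<^sup>2 * \<nu>' / 2)" .
qed (use assms in \<open>auto simp: subgaussian_def\<close>)

lemma subgaussian_scale:
  assumes "subgaussian M X \<nu>"
  shows "subgaussian M (\<lambda>\<omega>. c * X \<omega>) (c\<^sup>2 * \<nu>)"
proof -
  have X: "X \<in> borel_measurable M"
    "\<And>l. integrable M (\<lambda>\<omega>. exp (l * X \<omega>))" "\<And>l. (\<integral>\<omega>. exp (l * X \<omega>) \<partial>M) \<le> exp (l\<^sup>2 * \<nu> / 2)"
    using assms by (auto simp: subgaussian_def)
  have "(\<lambda>\<omega>. c * X \<omega>) \<in> borel_measurable M" using X(1) by measurable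
  then show ?thesis
    unfolding subgaussian_def using X(2,3)[of "_ * c"] by (simp add: mult.assoc power_mult_distrib)
qed

section \<open>Tails and independent sums of subgaussian variables\<close>

context prob_space
begin

lemma subgaussian_upper_tail:
  assumes X: "subgaussian M X \<nu>" and "0 < \<nu>" "0 < s"
  shows "prob {\<omega> \<in> space M. s \<le> X \<omega>} \<le> exp (- s\<^sup>2 / (2 * \<nu>))"
proof -
  \<comment> \<open>Minimises the Chernoff exponent
    \<open>- l * s + l\<^sup>2 * \<nu> / 2\<close>.\<close>
  define l where "l = s / \<nu>"
  have l: "l > 0" using assms by (simp add: l_def)
  have int: "integrable M (\<lambda>\<omega>. exp (l * X \<omega>))" using X by (simp add: subgaussian_def)
  have "prob {\<omega> \<in> space M. s \<le> X \<omega>} \<le> exp (- l * s) * (\<integral>\<omega>\<in>space M. exp (l * X \<omega>) \<partial>M)"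
    using int l by (intro Chernoff_ineq_ge) (auto simp: set_integrable_def cong: Bochner_Integration.integrable_cong)
  also have "(\<integral>\<omega>\<in>space M. exp (l * X \<omega>) \<partial>M) = (\<integral>\<omega>. exp (l * X \<omega>) \<partial>M)"
    using int by (rule set_integral_space)
  also have "exp (- l * s) * \<dots> \<le> exp (- l * s) * exp (l\<^sup>2 * \<nu> / 2)"
    using X by (intro mult_left_mono) (auto simp: subgaussian_def)
  also have "\<dots> = exp (- s\<^sup>2 / (2 * \<nu>))"
    unfolding exp_add[symmetric] using assms by (simp add: l_def field_simps power2_eq_square)
  finally show ?thesis .
qed

lemma subgaussian_tail:
  assumes X: "subgaussian M X \<nu>" and \<nu>: "0 < \<nu>" and s: "0 < s"
  shows "prob {\<omega> \<in> space M. s \<le> \<bar>X \<omega>\<bar>} \<le> 2 * exp (- s\<^sup>2 / (2 * \<nu>))"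
proof -
  have [measurable]: "X \<in> borel_measurable M" using X by (simp add: subgaussian_def)
  have X': "subgaussian M (\<lambda>\<omega>. - X \<omega>) \<nu>" using subgaussian_scale[OF X, of "-1"] by simp
  have "{\<omega> \<in> space M. s \<le> \<bar>X \<omega>\<bar>} = {\<omega> \<in> space M. s \<le> X \<omega>} \<union> {\<omega> \<in> space M. s \<le> - X \<omega>}"
    by (auto simp: abs_real_def)
  also have "prob \<dots> \<le> prob {\<omega> \<in> space M. s \<le> X \<omega>} + prob {\<omega> \<in> space M. s \<le> - X \<omega>}"
    by (intro measure_Un_le) measurable
  also have "\<dots> \<le> 2 * exp (- s\<^sup>2 / (2 * \<nu>))"
    using subgaussian_upper_tail[OF X \<nu> s] subgaussian_upper_tail[OF X' \<nu> s] by simp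
  finally show ?thesis .
qed

lemma subgaussian_union_tail:
  assumes J: "finite J" and X: "\<And>j. j \<in> J \<Longrightarrow> subgaussian M (X j) \<nu>" and \<nu>: "0 < \<nu>" and s: "0 < s"
  shows "{\<omega> \<in> space M. \<exists>j\<in>J. s \<le> \<bar>X j \<omega>\<bar>} \<in> events"
    and "prob {\<omega> \<in> space M. \<exists>j\<in>J. s \<le> \<bar>X j \<omega>\<bar>} \<le> real (card J) * (2 * exp (- s\<^sup>2 / (2 * \<nu>)))"
proof -
  have m: "{\<omega> \<in> space M. s \<le> \<bar>X j \<omega>\<bar>} \<in> events" if "j \<in> J" for j
  proof -
    have [measurable]: "X j \<in> borel_measurable M" using X[OF that] by (simp add: subgaussian_def)
    show ?thesis by measurable
  qed
  have eq: "{\<omega> \<in> space M. \<exists>j\<in>J. s \<le> \<bar>X j \<omega>\<bar>} = (\<Union>j\<in>J. {\<omega> \<in> space M. s \<le> \<bar>X j \<omega>\<bar>})" by auto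
  show "{\<omega> \<in> space M. \<exists>j\<in>J. s \<le> \<bar>X j \<omega>\<bar>} \<in> events"
    unfolding eq using J m by (intro sets.finite_UN) auto
  have "prob (\<Union>j\<in>J. {\<omega> \<in> space M. s \<le> \<bar>X j \<omega>\<bar>}) \<le> (\<Sum>j\<in>J. prob {\<omega> \<in> space M. s \<le> \<bar>X j \<omega>\<bar>})"
    using J m by (intro finite_measure_subadditive_finite) auto
  also have "\<dots> \<le> (\<Sum>j\<in>J. 2 * exp (- s\<^sup>2 / (2 * \<nu>)))"
    by (intro sum_mono subgaussian_tail X \<nu> s)
  finally show "prob {\<omega> \<in> space M. \<exists>j\<in>J. s \<le> \<bar>X j \<omega>\<bar>} \<le> real (card J) * (2 * exp (- s\<^sup>2 / (2 * \<nu>)))"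
    unfolding eq by simp
qed

text \<open>Under independence the moment generating functions multiply, so the variance proxies
  add.\<close>

lemma subgaussian_sum:
  assumes ind: "indep_vars (\<lambda>_. borel) X I" and I: "finite I"
    and X: "\<And>i. i \<in> I \<Longrightarrow> subgaussian M (X i) (\<nu> i)"
  shows "subgaussian M (\<lambda>\<omega>. \<Sum>i\<in>I. X i \<omega>) (\<Sum>i\<in>I. \<nu> i)"
  unfolding subgaussian_def
proof (intro conjI allI)
  show "(\<lambda>\<omega>. \<Sum>i\<in>I. X i \<omega>) \<in> borel_measurable M"
    using X by (intro borel_measurable_sum) (auto simp: subgaussian_def)
  fix l :: real
  have ind': "indep_vars (\<lambda>_. borel) (\<lambda>i \<omega>. exp (l * X i \<omega>)) I"
    by (rule indep_vars_compose2[OF ind]) measurable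
  have int: "integrable M (\<lambda>\<omega>. exp (l * X i \<omega>))" if "i \<in> I" for i
    using X[OF that] by (simp add: subgaussian_def)
  have eq: "exp (l * (\<Sum>i\<in>I. X i \<omega>)) = (\<Prod>i\<in>I. exp (l * X i \<omega>))" for \<omega>
    using I by (simp add: sum_distrib_left exp_sum)
  show "integrable M (\<lambda>\<omega>. exp (l * (\<Sum>i\<in>I. X i \<omega>)))"
    unfolding eq by (intro indep_vars_integrable I ind' int)
  have "(\<integral>\<omega>. exp (l * (\<Sum>i\<in>I. X i \<omega>)) \<partial>M) = (\<Prod>i\<in>I. \<integral>\<omega>. exp (l * X i \<omega>) \<partial>M)"
    unfolding eq by (intro indep_vars_lebesgue_integral I ind' int)
  also have "\<dots> \<le> (\<Prod>i\<in>I. exp (l\<^sup>2 * \<nu> i / 2))"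
    using X by (intro prod_mono) (auto simp: subgaussian_def)
  also have "\<dots> = exp (l\<^sup>2 * (\<Sum>i\<in>I. \<nu> i) / 2)"
    using I by (simp add: exp_sum[symmetric] sum_distrib_left sum_divide_distrib)
  finally show "(\<integral>\<omega>. exp (l * (\<Sum>i\<in>I. X i \<omega>)) \<partial>M) \<le> exp (l\<^sup>2 * (\<Sum>i\<in>I. \<nu> i) / 2)" .
qed

lemma subgaussian_ip:
  assumes subg: "\<And>u. (\<Sum>t<T. (u t)\<^sup>2) = 1 \<Longrightarrow> subgaussian M (\<lambda>\<omega>. \<Sum>t<T. u t * N \<omega> t) \<nu>"
  shows "subgaussian M (\<lambda>\<omega>. ip T v (N \<omega>)) ((nrm T v)\<^sup>2 * \<nu>)"
proof (cases "nrm T v = 0")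
  case True
  then have "ip T v (N \<omega>) = 0" for \<omega> by (simp add: ip_def nrm_eq_0)
  then show ?thesis using True by (simp add: subgaussian_def prob_space)
next
  case False
  define u where "u = (\<lambda>t. 1 / nrm T v * v t)"
  have "nrm T u = 1" unfolding u_def nrm_scale using False by simp
  then have "subgaussian M (\<lambda>\<omega>. ip T u (N \<omega>)) \<nu>"
    unfolding ip_def by (intro subg) (simp add: nrm_sq[symmetric])
  from subgaussian_scale[OF this, of "nrm T v"] show ?thesis
    using False unfolding u_def ip_scale_left by simp
qed

text \<open>Independence holds across rows only; dependence inside a row is covered by the
  assumption on its linear functionals.\<close>

lemma subgaussian_bilinear:
  fixes n :: nat
  assumes ind: "indep_vars (\<lambda>_. PiM {..<T} (\<lambda>_. borel)) (\<lambda>i \<omega>. restrict (\<lambda>t. N \<omega> i t) {..<T}) {..<n}"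
    and subg: "\<And>i u. i < n \<Longrightarrow> (\<Sum>t<T. (u t)\<^sup>2) = 1 \<Longrightarrow>
                 subgaussian M (\<lambda>\<omega>. \<Sum>t<T. u t * N \<omega> i t) (\<nu> i)"
  shows "subgaussian M (\<lambda>\<omega>. \<Sum>i<n. c i * ip T v (N \<omega> i)) (\<Sum>i<n. (c i)\<^sup>2 * ((nrm T v)\<^sup>2 * \<nu> i))"
proof (rule subgaussian_sum)
  have "indep_vars (\<lambda>_. borel) (\<lambda>i \<omega>. c i * (\<Sum>t<T. v t * restrict (\<lambda>t. N \<omega> i t) {..<T} t)) {..<n}"
    by (rule indep_vars_compose2[OF ind]) measurable
  then show "indep_vars (\<lambda>_. borel) (\<lambda>i \<omega>. c i * ip T v (N \<omega> i)) {..<n}"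
    by (simp add: ip_def)
  show "subgaussian M (\<lambda>\<omega>. c i * ip T v (N \<omega> i)) ((c i)\<^sup>2 * ((nrm T v)\<^sup>2 * \<nu> i))" if "i \<in> {..<n}" for i
    using that subg by (intro subgaussian_scale subgaussian_ip) auto
qed simp

end

section \<open>Noisy time series\<close>

text \<open>Centring is an orthogonal projection: it lowers the squared norm by T times the squared
  mean.\<close>

lemma nrm_center_le: "nrm T (\<lambda>t. y t - 1 / real T * (\<Sum>s<T. y s)) \<le> nrm T y"
proof (cases "T = 0")
  case False
  define m where "m = 1 / real T * (\<Sum>s<T. y s)"
  have S: "(\<Sum>s<T. y s) = real T * m" using False by (simp add: m_def)
  have "(\<Sum>t<T. (y t - m)\<^sup>2) = (\<Sum>t<T. (y t)\<^sup>2 - 2 * m * y t + m\<^sup>2)"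
    by (intro sum.cong) (auto simp: power2_diff)
  also have "\<dots> = (\<Sum>t<T. (y t)\<^sup>2) - 2 * m * (\<Sum>t<T. y t) + real T * m\<^sup>2"
    by (simp add: sum.distrib sum_subtractf sum_distrib_left)
  also have "\<dots> = (\<Sum>t<T. (y t)\<^sup>2) - real T * m\<^sup>2" unfolding S by (simp add: power2_eq_square)
  also have "\<dots> \<le> (\<Sum>t<T. (y t)\<^sup>2)" by simp
  finally show ?thesis unfolding m_def nrm_def by (rule real_sqrt_le_mono)
qed (simp add: nrm_def)

section \<open>Bounds on the dimension and the eigenvalues of the signal\<close>

context signal_rows
begin

lemma sum_U_sq_le:
  assumes "i < n"
  shows "(\<Sum>a<d. (U i a)\<^sup>2) \<le> 1"
proof -
  let ?e = "\<lambda>j. if j = i then 1 else (0::real)"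
  have "ip n (\<lambda>j. U j a) ?e = (\<Sum>j<n. if j = i then U j a else 0)" for a
    unfolding ip_def by (intro sum.cong) auto
  then have e: "ip n (\<lambda>j. U j a) ?e = U i a" for a using assms by simp
  have "(\<Sum>j<n. (?e j)\<^sup>2) = (\<Sum>j<n. if j = i then 1 else 0)" by (intro sum.cong) auto
  then have "nrm n ?e = 1" using assms by (simp add: nrm_def)
  with bessel[OF U_sys, of ?e] have "nrm d (U i) \<le> 1" by (simp add: e)
  then show ?thesis by (simp add: nrm_def)
qed

text \<open>The squared Frobenius norm of \<open>U\<close> is d when summed by columns and at most n
  when summed by rows.\<close>

lemma d_le_n: "d \<le> n"
proof -
  have "real d = (\<Sum>a<d. \<Sum>i<n. (U i a)\<^sup>2)" by (simp add: power2_eq_square U_sum)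
  also have "\<dots> = (\<Sum>i<n. \<Sum>a<d. (U i a)\<^sup>2)" by (rule sum.swap)
  also have "\<dots> \<le> (\<Sum>i<n. 1)" by (intro sum_mono sum_U_sq_le) auto
  finally show ?thesis by simp
qed

text \<open>This eigenvalue is the squared norm of a column of \<open>X\<close>, whose entries are
  at most 1 in modulus. It later lets 1 / T be exchanged for a multiple of 1 /
  \<open>lamS (d - 1)\<close>.\<close>

lemma lam_last_le: "lamS (d - 1) \<le> real n"
proof -
  have "lamS (d - 1) = (\<Sum>i<n. (U i (d - 1))\<^sup>2 * lamS (d - 1))"
    unfolding sum_distrib_right[symmetric] using U_sum[of "d - 1" "d - 1"] d_pos
    by (simp add: power2_eq_square)
  also have "\<dots> \<le> (\<Sum>i<n. 1)"
  proof (intro sum_mono)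
    fix i assume "i \<in> {..<n}"
    then have i: "i < n" by simp
    have "\<bar>X i (d - 1)\<bar> \<le> 1" using abs_le_nrm[of "d - 1" d "X i"] nrm_X[OF i] d_pos by simp
    then have "(X i (d - 1))\<^sup>2 \<le> 1\<^sup>2" unfolding abs_le_square_iff[symmetric] by simp
    then show "(U i (d - 1))\<^sup>2 * lamS (d - 1) \<le> 1"
      using lam_pos[of "d - 1"] d_pos by (simp add: embed_def power_mult_distrib)
  qed
  finally show ?thesis by simp
qed

text \<open>Row i of Y Y^T is X_i Lambda^(1/2) U^T with X_i a unit vector. Its size pays for the
  terms quadratic in the noise.\<close>

lemma nrm_corr_row_ge:
  assumes "i < n"
  shows "sqrt (lamS (d - 1)) \<le> nrm n (\<lambda>j. ip T (Y i) (Y j))"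
proof -
  have "sqrt (lamS (d - 1)) = nrm d (\<lambda>a. sqrt (lamS (d - 1)) * X i a)"
    using lam_pos[of "d - 1"] d_pos nrm_X[OF assms] by (simp add: nrm_scale)
  also have "\<dots> \<le> nrm d (\<lambda>a. sqrt (lamS a) * X i a)"
    unfolding nrm_def
  proof (intro real_sqrt_le_mono sum_mono)
    fix a assume "a \<in> {..<d}"
    then have "lamS (d - 1) \<le> lamS a" "0 \<le> lamS (d - 1)" using lam_dec[of a "d - 1"] lam_pos[of "d - 1"] by auto
    then show "(sqrt (lamS (d - 1)) * X i a)\<^sup>2 \<le> (sqrt (lamS a) * X i a)\<^sup>2"
      by (simp add: power_mult_distrib mult_right_mono)
  qed
  also have "\<dots> = nrm d (\<lambda>a. U i a * lamS a)"
    by (intro nrm_cong) (simp add: embed_def lam_pos less_imp_le)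
  also have "\<dots> = nrm n (lincomb d (\<lambda>a. U i a * lamS a) (\<lambda>a j. U j a))"
    by (rule nrm_orthonormal_lincomb[OF U_sys, symmetric])
  also have "\<dots> = nrm n (\<lambda>j. ip T (Y i) (Y j))"
    using assms by (intro nrm_cong) (simp add: decomp lincomb_def)
  finally show ?thesis .
qed

end

definition unit_rows :: "nat \<Rightarrow> (nat \<Rightarrow> nat \<Rightarrow> real) \<Rightarrow> nat \<Rightarrow> nat \<Rightarrow> real" where
  "unit_rows T Z i t = (Z i t - row_mean T Z i) / (sqrt (real T) * sqrt (sig2 T Z i))"

lemma corr_eq_ip: "corr T Z i j = ip T (unit_rows T Z i) (unit_rows T Z j)"
proof -
  have "ip T (unit_rows T Z i) (unit_rows T Z j)
    = (\<Sum>t<T. (Z i t - row_mean T Z i) * (Z j t - row_mean T Z j))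
        / (real T * (sqrt (sig2 T Z i) * sqrt (sig2 T Z j)))"
    unfolding ip_def sum_divide_distrib by (intro sum.cong) (auto simp: unit_rows_def)
  then show ?thesis by (simp add: corr_def cgram_def)
qed

lemma nrm_centered_row:
  assumes "0 < T"
  shows "nrm T (\<lambda>t. Z i t - row_mean T Z i) = sqrt (real T) * sqrt (sig2 T Z i)"
  using assms by (simp add: nrm_def sig2_def real_sqrt_mult[symmetric])

section \<open>The random noise and its high-probability event\<close>

locale noisy_series = prob_space M for M :: "'a measure" +
  fixes n T d :: nat and Zs Us :: "nat \<Rightarrow> nat \<Rightarrow> real" and lamS nu :: "nat \<Rightarrow> real"
    and N :: "'a \<Rightarrow> nat \<Rightarrow> nat \<Rightarrow> real" and \<gamma> :: real
  assumes n_ge: "2 \<le> n" and T_pos: "0 < T" and d_pos': "0 < d"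
    and sig_pos: "\<And>i. i < n \<Longrightarrow> sig2 T Zs i > 0"
    and Us_orth: "orthonormal_cols n d Us"
    and lamS_pos: "\<And>a. a < d \<Longrightarrow> lamS a > 0"
    and lamS_dec: "\<And>a b. a \<le> b \<Longrightarrow> b < d \<Longrightarrow> lamS b \<le> lamS a"
    and Rs_decomp: "\<And>i j. i < n \<Longrightarrow> j < n \<Longrightarrow> corr T Zs i j = (\<Sum>a<d. Us i a * lamS a * Us j a)"
    and indep: "indep_vars (\<lambda>_. PiM {..<T} (\<lambda>_. borel)) (\<lambda>i \<omega>. restrict (\<lambda>t. N \<omega> i t) {..<T}) {..<n}"
    and subg: "\<And>i u. i < n \<Longrightarrow> (\<Sum>t<T. (u t)\<^sup>2) = 1 \<Longrightarrow>
                 subgaussian M (\<lambda>\<omega>. \<Sum>t<T. u t * N \<omega> i t) (nu i)"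
    and gamma_pos: "0 < \<gamma>" and nu_le: "\<And>i. i < n \<Longrightarrow> nu i \<le> sig2 T Zs i / \<gamma>"
begin

definition scale :: "nat \<Rightarrow> real" where
  "scale i = 1 / (sqrt (real T) * sqrt (sig2 T Zs i))"

lemma scale_sq: "i < n \<Longrightarrow> (scale i)\<^sup>2 = 1 / (real T * sig2 T Zs i)"
  using sig_pos[of i] by (simp add: scale_def power_divide power_mult_distrib)

lemma scale_pos: "i < n \<Longrightarrow> 0 < scale i"
  using sig_pos[of i] T_pos by (simp add: scale_def)

text \<open>The variance proxy, in a unit direction, of a noise row after normalisation by the
  signal.\<close>

lemma scale_nu_le:
  assumes "i < n" shows "(scale i)\<^sup>2 * nu i \<le> 1 / (\<gamma> * real T)"
proof -
  have "(scale i)\<^sup>2 * nu i \<le> (scale i)\<^sup>2 * (sig2 T Zs i / \<gamma>)"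
    using nu_le[OF assms] by (intro mult_left_mono) auto
  also have "\<dots> = 1 / (\<gamma> * real T)"
    using sig_pos[OF assms] by (simp add: scale_sq[OF assms])
  finally show ?thesis .
qed

text \<open>The noise before centring. Tails are proved for \<open>B\<close>, to which the
  subgaussian assumption applies directly, and then transferred to \<open>W\<close>.\<close>

definition B :: "'a \<Rightarrow> nat \<Rightarrow> nat \<Rightarrow> real" where
  "B \<omega> i t = scale i * N \<omega> i t"

definition W :: "'a \<Rightarrow> nat \<Rightarrow> nat \<Rightarrow> real" where
  "W \<omega> i t = B \<omega> i t - 1 / real T * (\<Sum>s<T. B \<omega> i s)"

sublocale signal_rows n T d "unit_rows T Zs" Us lamS
proof
  show "nrm T (unit_rows T Zs i) = 1" if "i < n" for i
  proof -
    have "unit_rows T Zs i = (\<lambda>t. scale i * (Zs i t - row_mean T Zs i))"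
      by (simp add: unit_rows_def scale_def fun_eq_iff)
    then have "nrm T (unit_rows T Zs i) = scale i * (sqrt (real T) * sqrt (sig2 T Zs i))"
      using nrm_centered_row[OF T_pos, of Zs i] scale_pos[OF that] by (simp add: nrm_scale)
    then show ?thesis using T_pos sig_pos[OF that] by (simp add: scale_def)
  qed
  show "ip T (unit_rows T Zs i) (unit_rows T Zs j) = (\<Sum>a<d. Us i a * lamS a * Us j a)"
    if "i < n" "j < n" for i j
    using Rs_decomp[OF that] by (simp add: corr_eq_ip)
qed (use d_pos' Us_orth lamS_pos lamS_dec in auto)

text \<open>The signal rows are centred, so the singular vectors are orthogonal to constants and do
  not see the centring of the noise.\<close>

lemma sum_V: "(\<Sum>t<T. V a t) = 0"
proof -
  have "(\<Sum>t<T. unit_rows T Zs i t) = 0" for i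
    unfolding unit_rows_def sum_divide_distrib[symmetric]
    using T_pos by (simp add: sum_subtractf row_mean_def)
  then have z: "(\<Sum>t<T. c * unit_rows T Zs i t) = 0" for c i
    by (simp add: sum_distrib_left[symmetric])
  then show ?thesis
    unfolding V_def lincomb_def by (subst sum.swap) (simp only: z sum.neutral_const)
qed

lemma ip_V_W: "ip T (V a) (W \<omega> i) = ip T (V a) (B \<omega> i)"
proof -
  have "ip T (V a) (W \<omega> i) = ip T (V a) (B \<omega> i) - (\<Sum>t<T. V a t) * (1 / real T * (\<Sum>s<T. B \<omega> i s))"
    by (simp add: W_def[abs_def] ip_def right_diff_distrib sum_subtractf sum_distrib_right sum_divide_distrib)
  then show ?thesis by (simp add: sum_V)
qed

text \<open>Centring acts on the time index, commutes with combinations of rows, and is a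
  contraction.\<close>

lemma nrm_lincomb_W_le: "nrm T (lincomb n x (W \<omega>)) \<le> nrm T (lincomb n x (B \<omega>))"
proof -
  have "lincomb n x (W \<omega>) t = lincomb n x (B \<omega>) t - 1 / real T * (\<Sum>s<T. lincomb n x (B \<omega>) s)" for t
  proof -
    have "(\<Sum>s<T. lincomb n x (B \<omega>) s) = (\<Sum>i<n. x i * (\<Sum>s<T. B \<omega> i s))"
      unfolding lincomb_def sum_distrib_left by (rule sum.swap)
    then show ?thesis
      by (simp add: lincomb_def W_def right_diff_distrib sum_subtractf sum_distrib_left sum_divide_distrib)
  qed
  then have "nrm T (lincomb n x (W \<omega>))
      = nrm T (\<lambda>t. lincomb n x (B \<omega>) t - 1 / real T * (\<Sum>s<T. lincomb n x (B \<omega>) s))"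
    by (intro nrm_cong)
  then show ?thesis using nrm_center_le[of T "lincomb n x (B \<omega>)"] by simp
qed

text \<open>Positive row scaling does not affect normalised rows, so division by the true deviation
  followed by renormalisation gives the noisy normalisation.\<close>

lemma unit_rows_noisy:
  assumes "i < n"
  shows "unit_rows T (\<lambda>i t. Zs i t + N \<omega> i t) i t
    = 1 / nrm T (\<lambda>t. unit_rows T Zs i t + W \<omega> i t) * (unit_rows T Zs i t + W \<omega> i t)"
proof -
  define Z where "Z = (\<lambda>i t. Zs i t + N \<omega> i t)"
  have s: "scale i > 0" by (rule scale_pos[OF assms])
  have m: "row_mean T Z i = row_mean T Zs i + 1 / real T * (\<Sum>s<T. N \<omega> i s)"
    by (simp add: row_mean_def Z_def sum.distrib algebra_simps)
  have "unit_rows T Zs i t = scale i * (Zs i t - row_mean T Zs i)" for t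
    by (simp add: unit_rows_def scale_def)
  moreover have "W \<omega> i t = scale i * (N \<omega> i t - 1 / real T * (\<Sum>s<T. N \<omega> i s))" for t
    by (simp add: W_def B_def sum_distrib_left[symmetric] right_diff_distrib)
  ultimately have e: "unit_rows T Zs i t + W \<omega> i t = scale i * (Z i t - row_mean T Z i)" for t
    unfolding m by (simp add: Z_def algebra_simps)
  show ?thesis
    unfolding e nrm_scale nrm_centered_row[OF T_pos] Z_def[symmetric]
    using s by (simp add: unit_rows_def)
qed

text \<open>The 14 turns the Gaussian tail into exp (-7 (n + T)), which beats the exp (6 (n + T))
  pairs of net points; the outer 4 in \<open>w\<close> is the net factor. The 6 gives the tail
  n^(-3) against n d <= n^2 projections. Each failure has probability at most 2 / n.\<close>

theorem embedding_event:
  assumes pK: "p = sqrt (real d) * sqrt (6 * ln (real n) / (\<gamma> * real T))"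
    and wK: "w = 4 * sqrt (14 * (real n + real T) / (\<gamma> * real T))"
    and small_row: "2 * p + w\<^sup>2 \<le> 1 / 2"
    and small_scale: "(2 * p + w\<^sup>2) * sqrt (lamS 0) \<le> sqrt (lamS (d - 1)) / 4"
    and small_w: "2 * w \<le> sqrt (lamS (d - 1)) / 4"
  obtains A where "A \<in> events" "prob A \<ge> 1 - 4 / real n"
    "\<And>\<omega> Uh lam. \<omega> \<in> A \<Longrightarrow> top_eigenpairs n d (corr T (\<lambda>i t. Zs i t + N \<omega> i t)) Uh lam \<Longrightarrow>
       (INF Q\<in>orth_mats d. norm_2inf n d (\<lambda>i a. embed Uh lam i a - matmul d (embed Us lamS) Q i a))
         \<le> 4 * p + w\<^sup>2 * (1 + 8 / sqrt (lamS (d - 1)) + 32 / lamS (d - 1))"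
proof -
  define \<tau> where "\<tau> = 1 / (\<gamma> * real T)"
  have \<tau>: "\<tau> > 0" using gamma_pos T_pos by (simp add: \<tau>_def)
  define K1 where "K1 = sqrt (14 * (real n + real T) / (\<gamma> * real T))"
  define K2 where "K2 = sqrt (6 * ln (real n) / (\<gamma> * real T))"
  have lnn: "ln (real n) > 0" using n_ge by simp
  have K1: "K1 > 0" "K1\<^sup>2 = 14 * (real n + real T) * \<tau>"
    using gamma_pos T_pos by (auto simp: K1_def \<tau>_def)
  have K2: "K2 > 0" "K2\<^sup>2 = 6 * ln (real n) * \<tau>"
    using gamma_pos T_pos lnn by (auto simp: K2_def \<tau>_def)
  define X1 where "X1 = (\<lambda>(u, v) \<omega>. ip T v (lincomb n u (B \<omega>)))"
  define X2 where "X2 = (\<lambda>(i, a) \<omega>. ip T (V a) (B \<omega> i))"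
  define J1 where "J1 = net n \<times> net T"
  define J2 where "J2 = {..<n} \<times> {..<d}"
  have J: "finite J1" "finite J2" by (auto simp: J1_def J2_def finite_net)
  have S1: "subgaussian M (X1 j) \<tau>" if jJ: "j \<in> J1" for j
  proof -
    obtain u v where j: "j = (u, v)" "u \<in> net n" "v \<in> net T" using jJ by (auto simp: J1_def)
    have "X1 j = (\<lambda>\<omega>. \<Sum>i<n. (u i * scale i) * ip T v (N \<omega> i))"
      by (simp add: X1_def j(1) ip_lincomb_right B_def[abs_def] ip_scale_right mult.assoc)
    then have "subgaussian M (X1 j) (\<Sum>i<n. (u i * scale i)\<^sup>2 * ((nrm T v)\<^sup>2 * nu i))"
      using subgaussian_bilinear[OF indep subg, of "\<lambda>i. u i * scale i" v] by simp
    then show ?thesis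
    proof (rule subgaussian_mono)
      have v1: "(nrm T v)\<^sup>2 \<le> 1" and u1: "(nrm n u)\<^sup>2 \<le> 1"
        using nrm_net_le[OF j(3)] nrm_net_le[OF j(2)] by (auto simp: power_le_one)
      have "(\<Sum>i<n. (u i * scale i)\<^sup>2 * ((nrm T v)\<^sup>2 * nu i))
          = (\<Sum>i<n. ((u i)\<^sup>2 * (nrm T v)\<^sup>2) * ((scale i)\<^sup>2 * nu i))"
        by (simp add: power_mult_distrib mult_ac)
      also have "\<dots> \<le> (\<Sum>i<n. ((u i)\<^sup>2 * (nrm T v)\<^sup>2) * \<tau>)"
        unfolding \<tau>_def by (intro sum_mono mult_left_mono scale_nu_le) auto
      also have "\<dots> = (nrm n u)\<^sup>2 * (nrm T v)\<^sup>2 * \<tau>"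
        by (simp add: nrm_sq sum_distrib_right)
      also have "\<dots> \<le> 1 * \<tau>"
        using \<tau> mult_mono[OF u1 v1] by (intro mult_right_mono) auto
      finally show "(\<Sum>i<n. (u i * scale i)\<^sup>2 * ((nrm T v)\<^sup>2 * nu i)) \<le> \<tau>" by simp
    qed
  qed
  have S2: "subgaussian M (X2 j) \<tau>" if jJ: "j \<in> J2" for j
  proof -
    obtain i a where j: "j = (i, a)" "i < n" "a < d" using jJ by (auto simp: J2_def)
    have "nrm T (V a) = 1"
    proof -
      have "(nrm T (V a))\<^sup>2 = 1" using V_orth j(3) by (simp add: orthonormal_sys_def ip_self[symmetric])
      then show ?thesis using nrm_nonneg[of T "V a"] by (simp add: power2_eq_1_iff)
    qed
    then have "subgaussian M (\<lambda>\<omega>. ip T (V a) (N \<omega> i)) (nu i)"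
      using subgaussian_ip[of T "\<lambda>\<omega>. N \<omega> i" "nu i" "V a"] subg[OF j(2)] by simp
    from subgaussian_scale[OF this, of "scale i"]
    have "subgaussian M (X2 j) ((scale i)\<^sup>2 * nu i)"
      by (simp add: X2_def j(1) B_def[abs_def] ip_scale_right)
    then show ?thesis by (rule subgaussian_mono) (simp add: \<tau>_def scale_nu_le j(2))
  qed
  define B1 where "B1 = {\<omega> \<in> space M. \<exists>j\<in>J1. K1 \<le> \<bar>X1 j \<omega>\<bar>}"
  define B2 where "B2 = {\<omega> \<in> space M. \<exists>j\<in>J2. K2 \<le> \<bar>X2 j \<omega>\<bar>}"
  note t1 = subgaussian_union_tail[where X = X1, OF J(1) S1 \<tau> K1(1), folded B1_def]
  note t2 = subgaussian_union_tail[where X = X2, OF J(2) S2 \<tau> K2(1), folded B2_def]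
  have "prob B1 \<le> 2 / real n"
  proof -
    have e: "- K1\<^sup>2 / (2 * \<tau>) = - (7 * (real n + real T))"
      using \<tau> by (simp add: K1(2) field_simps)
    have "real (card J1) \<le> exp (6 * real n) * exp (6 * real T)"
      unfolding J1_def card_cartesian_product of_nat_mult by (intro mult_mono card_net_le) auto
    then have "real (card J1) * (2 * exp (- K1\<^sup>2 / (2 * \<tau>)))
        \<le> exp (6 * real n) * exp (6 * real T) * (2 * exp (- K1\<^sup>2 / (2 * \<tau>)))"
      by (intro mult_right_mono) auto
    also have "\<dots> = 2 * exp (6 * real n + 6 * real T + - (7 * (real n + real T)))"
      unfolding exp_add e by simp
    also have "\<dots> \<le> 2 * exp (- real n)" by simp
    also have "\<dots> \<le> 2 / real n"
    proof -
      have "real n \<le> exp (real n)" using exp_ge_add_one_self[of "real n"] by linarith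
      then show ?thesis using n_ge by (simp add: exp_minus field_simps)
    qed
    finally show ?thesis using t1(2) by linarith
  qed
  moreover have "prob B2 \<le> 2 / real n"
  proof -
    have "exp (- K2\<^sup>2 / (2 * \<tau>)) = exp (- (3 * ln (real n)))" using \<tau> by (simp add: K2(2))
    also have "\<dots> = 1 / exp (ln (real n)) ^ 3" by (simp add: exp_minus exp_of_nat_mult[symmetric] field_simps)
    also have "\<dots> = 1 / real n ^ 3" using n_ge by simp
    finally have e: "exp (- K2\<^sup>2 / (2 * \<tau>)) = 1 / real n ^ 3" .
    have "real (card J2) * (2 * exp (- K2\<^sup>2 / (2 * \<tau>))) \<le> (real n * real n) * (2 * (1 / real n ^ 3))"
      unfolding e J2_def using d_le_n by (intro mult_right_mono) (auto simp: card_cartesian_product mult_left_mono)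
    also have "\<dots> = 2 / real n" using n_ge by (simp add: field_simps power3_eq_cube)
    finally show ?thesis using t2(2) by linarith
  qed
  moreover define A where "A = space M - (B1 \<union> B2)"
  have "prob (B1 \<union> B2) \<le> prob B1 + prob B2" using t1(1) t2(1) by (intro measure_Un_le)
  moreover have "prob A = 1 - prob (B1 \<union> B2)" unfolding A_def using t1(1) t2(1) by (intro prob_compl) auto
  ultimately have "prob A \<ge> 1 - 4 / real n" by simp
  moreover have "A \<in> events" unfolding A_def using t1(1) t2(1) by auto
  moreover have "(INF Q\<in>orth_mats d. norm_2inf n d (\<lambda>i a. embed Uh lam i a - matmul d (embed Us lamS) Q i a))
         \<le> 4 * p + w\<^sup>2 * (1 + 8 / sqrt (lamS (d - 1)) + 32 / lamS (d - 1))" (is "_ \<le> ?b")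
    if \<omega>: "\<omega> \<in> A" and top: "top_eigenpairs n d (corr T (\<lambda>i t. Zs i t + N \<omega> i t)) Uh lam" for \<omega> Uh lam
  proof -
    have net: "\<bar>ip T v (lincomb n u (B \<omega>))\<bar> \<le> K1" if "u \<in> net n" "v \<in> net T" for u v
    proof -
      have "\<not> K1 \<le> \<bar>X1 (u, v) \<omega>\<bar>" using \<omega> that by (auto simp: A_def B1_def J1_def)
      then show ?thesis by (simp add: X1_def)
    qed
    have proj: "\<bar>ip T (V a) (B \<omega> i)\<bar> \<le> K2" if "a < d" "i < n" for a i
    proof -
      have "\<not> K2 \<le> \<bar>X2 (i, a) \<omega>\<bar>" using \<omega> that by (auto simp: A_def B2_def J2_def)
      then show ?thesis by (simp add: X2_def)
    qed
    interpret P: noisy_rows n T d "unit_rows T Zs" Us lamS "W \<omega>" p w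
    proof
      show "0 \<le> p" using K2(1) unfolding pK K2_def[symmetric] by simp
      show "0 \<le> w" using K1(1) unfolding wK K1_def[symmetric] by simp
      show "nrm T (lincomb n x (W \<omega>)) \<le> w * nrm n x" for x
        using nrm_lincomb_W_le[of x \<omega>] nrm_lincomb_le_net[OF net, of x] K1(1)
        unfolding wK K1_def[symmetric] by linarith
      show "nrm d (\<lambda>a. ip T (V a) (W \<omega> i)) \<le> p" if "i < n" for i
      proof -
        have "(ip T (V a) (B \<omega> i))\<^sup>2 \<le> K2\<^sup>2" if "a < d" for a
          using proj[OF that \<open>i < n\<close>] K2(1) unfolding abs_le_square_iff[symmetric] by simp
        then have "(\<Sum>a<d. (ip T (V a) (B \<omega> i))\<^sup>2) \<le> (\<Sum>a<d. K2\<^sup>2)" by (intro sum_mono) auto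
        then have "nrm d (\<lambda>a. ip T (V a) (W \<omega> i)) \<le> sqrt (real d * K2\<^sup>2)"
          unfolding nrm_def ip_V_W by simp
        also have "\<dots> = p" using K2(1) unfolding pK K2_def[symmetric] by (simp add: real_sqrt_mult)
        finally show ?thesis .
      qed
    qed (use small_row small_scale small_w in auto)
    have Yh: "unit_rows T (\<lambda>i t. Zs i t + N \<omega> i t) i t = P.Yh i t" if "i < n" for i t
      unfolding P.Yh_def P.D_def by (rule unit_rows_noisy[OF that])
    have "corr T (\<lambda>i t. Zs i t + N \<omega> i t) i j = ip T (P.Yh i) (P.Yh j)" if "i < n" "j < n" for i j
      unfolding corr_eq_ip using Yh that by (intro ip_cong) auto
    from P.embedding_perturbation[OF top this] obtain Q where Q: "Q \<in> orth_mats d"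
      and bd: "\<And>i. i < n \<Longrightarrow> nrm d (\<lambda>b. embed Uh lam i b - matmul d (embed Us lamS) Q i b) \<le> ?b"
      by blast
    define F where "F = (\<lambda>Q. norm_2inf n d (\<lambda>i a. embed Uh lam i a - matmul d (embed Us lamS) Q i a))"
    have ne: "{..<n} \<noteq> {}" using n_ge by (auto simp: lessThan_empty_iff)
    \<comment> \<open>Nonnegativity is the lower bound that makes a real infimum lie below each of
      its values.\<close>
    have "0 \<le> F Q" for Q
      unfolding F_def norm_2inf_def using ne n_ge
      by (subst Max_ge_iff) (auto intro!: bexI[of _ 0] real_sqrt_ge_zero sum_nonneg)
    then have "(INF Q\<in>orth_mats d. F Q) \<le> F Q"
      by (intro cINF_lower bdd_belowI2[of _ 0] Q) auto
    also have "F Q \<le> ?b"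
      unfolding F_def norm_2inf_def using ne bd by (subst Max_le_iff) (auto simp: nrm_def)
    finally show ?thesis unfolding F_def .
  qed
  ultimately show ?thesis using that by blast
qed

end

section \<open>The asymptotic statement\<close>

lemma ln_ge_1: "3 \<le> x \<Longrightarrow> 1 \<le> ln x" for x :: real
  using exp_le by (subst ln_ge_iff) auto

section \<open>Comparison of the noise levels with the stated rate\<close>

context noisy_series
begin

lemma norm_2inf_corr_ge: "sqrt (lamS (d - 1)) \<le> norm_2inf n n (corr T Zs)"
proof -
  have "corr T Zs 0 = (\<lambda>j. ip T (unit_rows T Zs 0) (unit_rows T Zs j))"
    by (rule ext) (rule corr_eq_ip)
  then have "sqrt (lamS (d - 1)) \<le> nrm n (corr T Zs 0)"
    using nrm_corr_row_ge[of 0] n_ge by simp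
  also have "\<dots> \<le> norm_2inf n n (corr T Zs)"
    unfolding norm_2inf_def nrm_def using n_ge by (intro Max_ge) auto
  finally show ?thesis .
qed

text \<open>Both \<open>w\<^sup>2 * \<kappa>\<close> and the square of
  \<open>p * sqrt \<kappa>\<close> are at most constant multiples of \<open>\<epsilon>\<close>,
  which yields the smallness conditions. Then \<open>p\<close> is compared with the leading factor
  and w^2 with its product with the second summand. The 224 in \<open>b\<close> is 4^2 * 14.\<close>

theorem embedding_event_rate:
  fixes C0 c :: real
  defines "\<kappa> \<equiv> lamS 0 / lamS (d - 1)"
    and "b \<equiv> 224 * (C0 + 1)"
  defines "\<epsilon> \<equiv> \<kappa> * ln (real T) / \<gamma>"
  assumes C0: "1 \<le> C0" and c: "0 < c"
    and n3: "3 \<le> n" and T3: "3 \<le> T" and T_C0: "C0 \<le> real T"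
    and n_le: "real n \<le> C0 * real T" and lam_ge: "c \<le> lamS (d - 1)"
    and small1: "2 * sqrt (12 * C0 * \<epsilon>) + b * \<epsilon> \<le> 1 / 4" and small2: "b * \<epsilon> \<le> c / 64"
  obtains A where "A \<in> events" "prob A \<ge> 1 - 4 / real n"
    "\<And>\<omega> Uh lam. \<omega> \<in> A \<Longrightarrow> top_eigenpairs n d (corr T (\<lambda>i t. Zs i t + N \<omega> i t)) Uh lam \<Longrightarrow>
       (INF Q\<in>orth_mats d. norm_2inf n d (\<lambda>i a. embed Uh lam i a - matmul d (embed Us lamS) Q i a))
         \<le> (4 * sqrt (12 * C0) + b * (1 + 8 / sqrt c + 32 / c))
            * sqrt (real d * ln (real T) / (\<gamma> * lamS (d - 1)))
            * (1 + \<kappa> * (\<kappa> * sqrt (ln (real n) / \<gamma>) + sqrt (1 / real T)) * norm_2inf n n (corr T Zs))"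
proof -
  define p where "p = sqrt (real d) * sqrt (6 * ln (real n) / (\<gamma> * real T))"
  define w where "w = 4 * sqrt (14 * (real n + real T) / (\<gamma> * real T))"
  define l where "l = lamS (d - 1)"
  define L where "L = ln (real T)"
  have l: "l > 0" "c \<le> l" using c lam_ge by (auto simp: l_def)
  have Tp: "real T > 0" using T3 by simp
  have L1: "1 \<le> L" unfolding L_def using T3 by (intro ln_ge_1) simp
  have ln1: "1 \<le> ln (real n)" using n3 by (intro ln_ge_1) simp
  have ln2: "ln (real n) \<le> 2 * L"
  proof -
    have "ln (real n) \<le> ln (C0 * real T)" using n_le n3 by simp
    also have "\<dots> = ln C0 + L" using C0 Tp by (simp add: ln_mult L_def)
    \<comment> \<open>T >= C0 absorbs the constant into a second \<open>L\<close>.\<close>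
    also have "ln C0 \<le> L" unfolding L_def using C0 T_C0 by simp
    finally show ?thesis by simp
  qed
  have \<kappa>1: "1 \<le> \<kappa>" using lam_dec[of 0 "d - 1"] d_pos l by (simp add: \<kappa>_def l_def)
  have lam0: "sqrt (lamS 0) = sqrt \<kappa> * sqrt l"
    using l by (simp add: \<kappa>_def l_def real_sqrt_mult[symmetric])
  have p2: "p = sqrt (6 * real d * ln (real n) / (\<gamma> * real T))"
    unfolding p_def real_sqrt_mult[symmetric] by (simp add: mult_ac)
  have p0: "p \<ge> 0" using ln1 gamma_pos by (simp add: p_def)
  have dn: "real d \<le> C0 * real T" using d_le_n n_le by linarith
  have w2: "w\<^sup>2 = 224 * (real n + real T) / (\<gamma> * real T)"
    using gamma_pos by (simp add: w_def power_mult_distrib)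
  have w_le: "w\<^sup>2 \<le> b / \<gamma>"
  proof -
    have "w\<^sup>2 \<le> 224 * ((C0 + 1) * real T) / (\<gamma> * real T)"
      unfolding w2 using gamma_pos n_le by (intro divide_right_mono) (auto simp: algebra_simps)
    also have "\<dots> = b / \<gamma>" using Tp by (simp add: b_def)
    finally show ?thesis .
  qed
  have b0: "b > 0" using C0 by (simp add: b_def)
  have w\<kappa>: "w\<^sup>2 * \<kappa> \<le> b * \<epsilon>"
  proof -
    have "w\<^sup>2 * \<kappa> \<le> (b / \<gamma>) * \<kappa>" using w_le \<kappa>1 by (intro mult_right_mono) auto
    also have "\<dots> \<le> (b / \<gamma>) * (\<kappa> * L)"
      using \<kappa>1 L1 b0 gamma_pos by (intro mult_left_mono) auto
    also have "\<dots> = b * \<epsilon>" by (simp add: \<epsilon>_def L_def)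
    finally show ?thesis .
  qed
  have p\<kappa>: "p * sqrt \<kappa> \<le> sqrt (12 * C0 * \<epsilon>)"
  proof -
    have "6 * real d * ln (real n) / (\<gamma> * real T) * \<kappa> \<le> 6 * (C0 * real T) * (2 * L) / (\<gamma> * real T) * \<kappa>"
      using dn ln2 ln1 gamma_pos \<kappa>1 C0
      by (intro mult_right_mono divide_right_mono mult_mono) auto
    also have "\<dots> = 12 * C0 * \<epsilon>" using Tp by (simp add: \<epsilon>_def L_def)
    finally show ?thesis unfolding p2 real_sqrt_mult[symmetric] by simp
  qed
  have s\<kappa>: "1 \<le> sqrt \<kappa>" "sqrt \<kappa> \<le> \<kappa>"
    using \<kappa>1 by (auto intro: real_le_lsqrt simp: power2_eq_square)
  have scaled: "(2 * p + w\<^sup>2) * sqrt \<kappa> \<le> 1 / 4"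
  proof -
    have "w\<^sup>2 * sqrt \<kappa> \<le> w\<^sup>2 * \<kappa>" using s\<kappa> by (intro mult_left_mono) auto
    then have "(2 * p + w\<^sup>2) * sqrt \<kappa> \<le> 2 * sqrt (12 * C0 * \<epsilon>) + b * \<epsilon>"
      using p\<kappa> w\<kappa> by (simp add: distrib_right)
    then show ?thesis using small1 by linarith
  qed
  have row: "2 * p + w\<^sup>2 \<le> 1 / 2"
    using scaled mult_left_mono[OF s\<kappa>(1), of "2 * p + w\<^sup>2"] p0 by simp
  have sc: "(2 * p + w\<^sup>2) * sqrt (lamS 0) \<le> sqrt (lamS (d - 1)) / 4"
    using mult_right_mono[OF scaled, of "sqrt l"] l unfolding lam0 by (simp add: l_def mult.assoc)
  \<comment> \<open>(8 w)^2 = 64 w^2 <= 64 b \<epsilon> <= c, the reason for the 64 in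
    \<open>small2\<close>.\<close>
  have sw: "2 * w \<le> sqrt (lamS (d - 1)) / 4"
  proof -
    have "w\<^sup>2 \<le> w\<^sup>2 * \<kappa>" using mult_left_mono[OF \<kappa>1, of "w\<^sup>2"] by simp
    then have "(8 * w)\<^sup>2 \<le> l" using w\<kappa> small2 l(2) by (simp add: power_mult_distrib)
    then have "8 * w \<le> sqrt l" by (rule real_le_rsqrt)
    then show ?thesis by (simp add: l_def)
  qed
  obtain A where A: "A \<in> events" "prob A \<ge> 1 - 4 / real n"
    and bd: "\<And>\<omega> Uh lam. \<omega> \<in> A \<Longrightarrow> top_eigenpairs n d (corr T (\<lambda>i t. Zs i t + N \<omega> i t)) Uh lam \<Longrightarrow>
       (INF Q\<in>orth_mats d. norm_2inf n d (\<lambda>i a. embed Uh lam i a - matmul d (embed Us lamS) Q i a))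
         \<le> 4 * p + w\<^sup>2 * (1 + 8 / sqrt (lamS (d - 1)) + 32 / lamS (d - 1))"
    using embedding_event[OF p_def w_def row sc sw] by blast
  define S where "S = sqrt (real d * L / (\<gamma> * l))"
  define E where "E = \<kappa> * (\<kappa> * sqrt (ln (real n) / \<gamma>) + sqrt (1 / real T)) * norm_2inf n n (corr T Zs)"
  define c1 where "c1 = 1 + 8 / sqrt c + 32 / c"
  have S0: "S \<ge> 0" using L1 gamma_pos l by (simp add: S_def)
  have c1: "c1 > 0" using c by (simp add: c1_def add_pos_pos)
  have pS: "p \<le> sqrt (12 * C0) * S"
  proof -
    \<comment> \<open>The eigenvalue is at most n, hence at most C0 T; this replaces T by the
      eigenvalue in the rate.\<close>
    have "l \<le> C0 * real T" using lam_last_le n_le unfolding l_def by linarith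
    then have "1 / real T \<le> C0 / l" using Tp l by (simp add: field_simps)
    then have "(6 * real d * ln (real n) / \<gamma>) * (1 / real T) \<le> (6 * real d * (2 * L) / \<gamma>) * (C0 / l)"
      using ln1 ln2 gamma_pos L1 by (intro mult_mono divide_right_mono mult_left_mono) auto
    then have "6 * real d * ln (real n) / (\<gamma> * real T) \<le> 12 * C0 * (real d * L / (\<gamma> * l))"
      by (simp add: mult_ac)
    then show ?thesis unfolding p2 S_def real_sqrt_mult[symmetric] by simp
  qed
  have ES: "1 / \<gamma> \<le> S * E"
  proof -
    \<comment> \<open>The factors are matched one by one: the first with \<open>S\<close>, sqrt (1 /
      \<gamma>) with the bracket, and sqrt l with the norm of the correlation matrix. This absorbs
      the quadratic noise terms.\<close>
    have "1 / \<gamma> = sqrt (1 / (\<gamma> * l)) * ((1 * (1 * sqrt (1 / \<gamma>))) * sqrt l)"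
    proof -
      have "sqrt (1 / (\<gamma> * l)) * (sqrt (1 / \<gamma>) * sqrt l) = sqrt ((1 / \<gamma>)\<^sup>2)"
        unfolding real_sqrt_mult[symmetric] using l gamma_pos by (simp add: power2_eq_square field_simps)
      then show ?thesis using gamma_pos by simp
    qed
    also have "\<dots> \<le> S * ((\<kappa> * (\<kappa> * sqrt (ln (real n) / \<gamma>) + sqrt (1 / real T))) * norm_2inf n n (corr T Zs))"
    proof (intro mult_mono)
      have "1 * 1 \<le> real d * L" using d_pos L1 by (intro mult_mono) auto
      then show "sqrt (1 / (\<gamma> * l)) \<le> S"
        unfolding S_def using gamma_pos l by (intro real_sqrt_le_mono divide_right_mono) auto
      have "1 * sqrt (1 / \<gamma>) \<le> \<kappa> * sqrt (ln (real n) / \<gamma>)"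
        using \<kappa>1 ln1 gamma_pos by (intro mult_mono real_sqrt_le_mono divide_right_mono) auto
      moreover have "sqrt (1 / real T) \<ge> 0" by simp
      ultimately show "1 * sqrt (1 / \<gamma>) \<le> \<kappa> * sqrt (ln (real n) / \<gamma>) + sqrt (1 / real T)" by linarith
      show "sqrt l \<le> norm_2inf n n (corr T Zs)" unfolding l_def by (rule norm_2inf_corr_ge)
    qed (use \<kappa>1 S0 l gamma_pos ln1 in auto)
    finally show ?thesis unfolding E_def .
  qed
  have E0: "E \<ge> 0"
  proof -
    have "norm_2inf n n (corr T Zs) \<ge> 0" using norm_2inf_corr_ge l by (smt (verit) l_def real_sqrt_ge_zero)
    then show ?thesis unfolding E_def using \<kappa>1 ln1 gamma_pos by simp
  qed
  have "4 * p + w\<^sup>2 * (1 + 8 / sqrt l + 32 / l) \<le> (4 * sqrt (12 * C0) + b * c1) * S * (1 + E)"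
  proof -
    have "1 + 8 / sqrt l + 32 / l \<le> c1"
      unfolding c1_def using c l by (intro add_mono divide_left_mono) auto
    then have "w\<^sup>2 * (1 + 8 / sqrt l + 32 / l) \<le> (b / \<gamma>) * c1"
      using w_le b0 gamma_pos l by (intro mult_mono) auto
    also have "\<dots> = b * c1 * (1 / \<gamma>)" by simp
    also have "\<dots> \<le> b * c1 * (S * E)" using ES b0 c1 by (intro mult_left_mono) auto
    finally have "4 * p + w\<^sup>2 * (1 + 8 / sqrt l + 32 / l) \<le> 4 * (sqrt (12 * C0) * S) + b * c1 * (S * E)"
      using pS by linarith
    also have "\<dots> \<le> (4 * sqrt (12 * C0) + b * c1) * S * (1 + E)"
    proof -
      have "0 \<le> sqrt (12 * C0) * S * E" "0 \<le> b * c1 * S" using S0 E0 C0 b0 c1 by auto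
      then show ?thesis by (simp add: algebra_simps)
    qed
    finally show ?thesis .
  qed
  note rate = this[unfolded S_def E_def c1_def l_def L_def]
  show ?thesis
    using that[OF A] order_trans[OF bd rate] by blast
qed

end

section \<open>Passage to the sequence of models\<close>

theorem mainTheorem1:
  fixes M :: "nat \<Rightarrow> 'a measure"
    and n T d :: "nat \<Rightarrow> nat"
    and Zs :: "nat \<Rightarrow> nat \<Rightarrow> nat \<Rightarrow> real"
    and N :: "nat \<Rightarrow> 'a \<Rightarrow> nat \<Rightarrow> nat \<Rightarrow> real"
    and nu :: "nat \<Rightarrow> nat \<Rightarrow> real"
    and Us :: "nat \<Rightarrow> nat \<Rightarrow> nat \<Rightarrow> real"
    and lamS :: "nat \<Rightarrow> nat \<Rightarrow> real"
  defines "Z \<equiv> (\<lambda>k \<omega> i t. Zs k i t + N k \<omega> i t)"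
    and "Rs \<equiv> (\<lambda>k. corr (T k) (Zs k))"
    and "\<kappa> \<equiv> (\<lambda>k. lamS k 0 / lamS k (d k - 1))"
    and "\<gamma> \<equiv> (\<lambda>k. Min ((\<lambda>i. sig2 (T k) (Zs k) i / nu k i) ` {..<n k}))"
  assumes prob: "\<And>k. prob_space (M k)"
    and n_lim: "filterlim n at_top sequentially"
    and T_lim: "filterlim T at_top sequentially"
    and sig_pos: "\<And>k i. i < n k \<Longrightarrow> sig2 (T k) (Zs k) i > 0"
    \<comment> \<open>spectral decomposition R* = U* Lambda* U*^T, d = rank R*\<close>
    and Us_orth: "\<And>k. orthonormal_cols (n k) (d k) (Us k)"
    and lamS_pos: "\<And>k a. a < d k \<Longrightarrow> lamS k a > 0"
    and lamS_dec: "\<And>k a b. a \<le> b \<Longrightarrow> b < d k \<Longrightarrow> lamS k b \<le> lamS k a"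
    and Rs_decomp: "\<And>k i j. i < n k \<Longrightarrow> j < n k \<Longrightarrow>
                      Rs k i j = (\<Sum>a<d k. Us k i a * lamS k a * Us k j a)"
    \<comment> \<open>Assumption 1\<close>
    and indep: "\<And>k. prob_space.indep_vars (M k) (\<lambda>_. PiM {..<T k} (\<lambda>_. borel))
                     (\<lambda>i \<omega>. restrict (\<lambda>t. N k \<omega> i t) {..<T k}) {..<n k}"
    and mean_zero: "\<And>k i t. i < n k \<Longrightarrow> t < T k \<Longrightarrow>
                      integrable (M k) (\<lambda>\<omega>. N k \<omega> i t) \<and> (\<integral>\<omega>. N k \<omega> i t \<partial>M k) = 0"
    and nu_pos: "\<And>k i. i < n k \<Longrightarrow> nu k i > 0"
    and subg: "\<And>k i u. i < n k \<Longrightarrow> (\<Sum>t<T k. (u t)\<^sup>2) = 1 \<Longrightarrow>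
                 subgaussian (M k) (\<lambda>\<omega>. \<Sum>t<T k. u t * N k \<omega> i t) (nu k i)"
    and n_O_T: "(\<lambda>k. real (n k)) \<in> O(\<lambda>k. real (T k))"
    \<comment> \<open>Assumption 2\<close>
    and lamd_Omega: "(\<lambda>k. lamS k (d k - 1)) \<in> \<Omega>(\<lambda>_. 1)"
    and kappa_o: "\<kappa> \<in> o(\<lambda>k. real (T k))"
    and kappa_gamma: "(\<lambda>k. \<kappa> k * ln (real (T k)) / \<gamma> k) \<longlonglongrightarrow> 0"
  shows "\<exists>C>0. \<exists>A :: nat \<Rightarrow> 'a set.
           (\<forall>k. A k \<in> sets (M k)) \<and>
           (\<lambda>k. measure (M k) (A k)) \<longlonglongrightarrow> 1 \<and>
           (\<forall>k. \<forall>\<omega>\<in>A k. \<forall>U lam.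
              top_eigenpairs (n k) (d k) (corr (T k) (Z k \<omega>)) U lam \<longrightarrow>
              (INF Q\<in>orth_mats (d k).
                 norm_2inf (n k) (d k)
                   (\<lambda>i a. embed U lam i a - matmul (d k) (embed (Us k) (lamS k)) Q i a))
              \<le> C * sqrt (real (d k) * ln (real (T k)) / (\<gamma> k * lamS k (d k - 1)))
                  * (1 + \<kappa> k * (\<kappa> k * sqrt (ln (real (n k)) / \<gamma> k) + sqrt (1 / real (T k)))
                             * norm_2inf (n k) (n k) (Rs k)))"
proof -
  obtain c0 where c0: "c0 > 0" "eventually (\<lambda>k. norm (real (n k)) \<le> c0 * norm (real (T k))) sequentially"
    using n_O_T by (elim landau_o.bigE) auto
  obtain c where c: "c > 0" "eventually (\<lambda>k. norm (lamS k (d k - 1)) \<ge> c * norm (1::real)) sequentially"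
    using lamd_Omega by (elim landau_omega.bigE) auto
  define C0 where "C0 = max c0 1"
  define b where "b = 224 * (C0 + 1)"
  define \<epsilon> where "\<epsilon> = (\<lambda>k. \<kappa> k * ln (real (T k)) / \<gamma> k)"
  \<comment> \<open>Depends only on the constants behind n = O(T) and the eigenvalue lower bound,
    not on the index \<open>k\<close>.\<close>
  define C where "C = 4 * sqrt (12 * C0) + b * (1 + 8 / sqrt c + 32 / c)"
  have C0: "1 \<le> C0" by (simp add: C0_def)
  have Cpos: "C > 0"
    using C0 c by (auto simp: C_def b_def intro!: add_pos_pos mult_pos_pos)
  have eps: "\<epsilon> \<longlonglongrightarrow> 0" using kappa_gamma by (simp add: \<epsilon>_def)
  define good where "good = (\<lambda>k. 3 \<le> n k \<and> 3 \<le> T k \<and> C0 \<le> real (T k) \<and> real (n k) \<le> C0 * real (T k) \<and>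
      c \<le> \<bar>lamS k (d k - 1)\<bar> \<and> 2 * sqrt (12 * C0 * \<epsilon> k) + b * \<epsilon> k \<le> 1 / 4 \<and> b * \<epsilon> k \<le> c / 64)"
  have good: "eventually good sequentially"
    unfolding good_def
  proof (intro eventually_conj)
    show "\<forall>\<^sub>F k in sequentially. 3 \<le> n k" using n_lim by (simp add: filterlim_at_top)
    show "\<forall>\<^sub>F k in sequentially. 3 \<le> T k" using T_lim by (simp add: filterlim_at_top)
    show "\<forall>\<^sub>F k in sequentially. C0 \<le> real (T k)"
      using filterlim_compose[OF filterlim_real_sequentially T_lim] by (simp add: filterlim_at_top)
    show "\<forall>\<^sub>F k in sequentially. real (n k) \<le> C0 * real (T k)"
      using c0(2)
    proof eventually_elim
      case (elim k)
      then have "real (n k) \<le> c0 * real (T k)" by simp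
      also have "\<dots> \<le> C0 * real (T k)" by (intro mult_right_mono) (auto simp: C0_def)
      finally show ?case .
    qed
    show "\<forall>\<^sub>F k in sequentially. c \<le> \<bar>lamS k (d k - 1)\<bar>" using c(2) by simp
    have "(\<lambda>k. 2 * sqrt (12 * C0 * \<epsilon> k) + b * \<epsilon> k) \<longlonglongrightarrow> 2 * sqrt (12 * C0 * 0) + b * 0"
      by (intro tendsto_intros eps)
    then have "(\<lambda>k. 2 * sqrt (12 * C0 * \<epsilon> k) + b * \<epsilon> k) \<longlonglongrightarrow> 0" by simp
    then have "\<forall>\<^sub>F k in sequentially. 2 * sqrt (12 * C0 * \<epsilon> k) + b * \<epsilon> k < 1 / 4"
      by (rule order_tendstoD) simp
    then show "\<forall>\<^sub>F k in sequentially. 2 * sqrt (12 * C0 * \<epsilon> k) + b * \<epsilon> k \<le> 1 / 4"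
      by eventually_elim simp
    have "(\<lambda>k. b * \<epsilon> k) \<longlonglongrightarrow> b * 0" by (intro tendsto_intros eps)
    then have "\<forall>\<^sub>F k in sequentially. b * \<epsilon> k < c / 64"
      by (rule order_tendstoD) (use c in simp)
    then show "\<forall>\<^sub>F k in sequentially. b * \<epsilon> k \<le> c / 64" by eventually_elim simp
  qed
  define bound where "bound = (\<lambda>k (A :: 'a set). \<forall>\<omega>\<in>A. \<forall>U lam.
              top_eigenpairs (n k) (d k) (corr (T k) (Z k \<omega>)) U lam \<longrightarrow>
              (INF Q\<in>orth_mats (d k).
                 norm_2inf (n k) (d k)
                   (\<lambda>i a. embed U lam i a - matmul (d k) (embed (Us k) (lamS k)) Q i a))
              \<le> C * sqrt (real (d k) * ln (real (T k)) / (\<gamma> k * lamS k (d k - 1)))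
                  * (1 + \<kappa> k * (\<kappa> k * sqrt (ln (real (n k)) / \<gamma> k) + sqrt (1 / real (T k)))
                             * norm_2inf (n k) (n k) (Rs k)))"
  \<comment> \<open>The finitely many indices that are not \<open>good\<close> receive the empty
    event: the bound is vacuous there and the limit of the probabilities is unaffected.\<close>
  have "\<exists>A. A \<in> sets (M k) \<and> (good k \<longrightarrow> 1 - 4 / real (n k) \<le> measure (M k) A) \<and> bound k A" for k
  proof (cases "good k")
    case False
    then show ?thesis by (intro exI[of _ "{}"]) (simp add: bound_def)
  next
    case True
    then have g: "3 \<le> n k" "3 \<le> T k" "C0 \<le> real (T k)" "real (n k) \<le> C0 * real (T k)"
      "c \<le> \<bar>lamS k (d k - 1)\<bar>" "2 * sqrt (12 * C0 * \<epsilon> k) + b * \<epsilon> k \<le> 1 / 4" "b * \<epsilon> k \<le> c / 64"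
      unfolding good_def by auto
    \<comment> \<open>With d = 0 the decomposition would make the diagonal of the correlation matrix
      vanish, contrary to positive signal power.\<close>
    have d: "0 < d k"
    proof (rule ccontr)
      assume "\<not> 0 < d k"
      then have "corr (T k) (Zs k) 0 0 = 0" using Rs_decomp[where i = 0 and j = 0 and k = k] g(1) by (simp add: Rs_def)
      moreover have "cgram (T k) (Zs k) 0 0 = sig2 (T k) (Zs k) 0"
        by (simp add: cgram_def sig2_def power2_eq_square)
      ultimately show False using sig_pos[where i = 0 and k = k] g(1) by (simp add: corr_def)
    qed
    have ne: "{..<n k} \<noteq> {}" using g(1) by (auto simp: lessThan_empty_iff)
    have \<gamma>: "0 < \<gamma> k"
      unfolding \<gamma>_def using ne sig_pos nu_pos by (subst Min_gr_iff) auto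
    have nu: "nu k i \<le> sig2 (T k) (Zs k) i / \<gamma> k" if "i < n k" for i
    proof -
      have "\<gamma> k \<le> sig2 (T k) (Zs k) i / nu k i"
        unfolding \<gamma>_def using that by (intro Min_le) auto
      then show ?thesis using \<gamma> nu_pos[OF that] by (simp add: field_simps)
    qed
    interpret P: prob_space "M k" by (rule prob)
    interpret S: noisy_series "M k" "n k" "T k" "d k" "Zs k" "Us k" "lamS k" "nu k" "N k" "\<gamma> k"
    proof
      show "corr (T k) (Zs k) i j = (\<Sum>a<d k. Us k i a * lamS k a * Us k j a)"
        if "i < n k" "j < n k" for i j using Rs_decomp[OF that] by (simp add: Rs_def)
    qed (use g d sig_pos Us_orth lamS_pos lamS_dec indep subg \<gamma> nu in auto)
    have lam_ge: "c \<le> lamS k (d k - 1)" using g(5) lamS_pos[where a = "d k - 1" and k = k] d by simp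
    show ?thesis
    proof (rule S.embedding_event_rate[OF C0 c(1) g(1-4) lam_ge g(6,7)[unfolded \<epsilon>_def \<kappa>_def b_def]])
      fix A assume A: "A \<in> sets (M k)" "measure (M k) A \<ge> 1 - 4 / real (n k)"
        and bd: "\<And>\<omega> U lam. \<omega> \<in> A \<Longrightarrow>
          top_eigenpairs (n k) (d k) (corr (T k) (\<lambda>i t. Zs k i t + N k \<omega> i t)) U lam \<Longrightarrow>
          (INF Q\<in>orth_mats (d k). norm_2inf (n k) (d k)
              (\<lambda>i a. embed U lam i a - matmul (d k) (embed (Us k) (lamS k)) Q i a))
            \<le> (4 * sqrt (12 * C0) + 224 * (C0 + 1) * (1 + 8 / sqrt c + 32 / c))
               * sqrt (real (d k) * ln (real (T k)) / (\<gamma> k * lamS k (d k - 1)))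
               * (1 + lamS k 0 / lamS k (d k - 1)
                    * (lamS k 0 / lamS k (d k - 1) * sqrt (ln (real (n k)) / \<gamma> k) + sqrt (1 / real (T k)))
                    * norm_2inf (n k) (n k) (corr (T k) (Zs k)))"
      have "bound k A"
        unfolding bound_def Z_def Rs_def \<kappa>_def C_def b_def by (intro ballI allI impI bd)
      then show ?thesis using A by blast
    qed
  qed
  then obtain A where A: "\<And>k. A k \<in> sets (M k)"
    "\<And>k. good k \<Longrightarrow> 1 - 4 / real (n k) \<le> measure (M k) (A k)" "\<And>k. bound k (A k)"
    by metis
  have "(\<lambda>k. measure (M k) (A k)) \<longlonglongrightarrow> 1"
  proof (rule tendsto_sandwich)
    show "\<forall>\<^sub>F k in sequentially. 1 - 4 / real (n k) \<le> measure (M k) (A k)"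
      using good by eventually_elim (rule A(2))
    show "\<forall>\<^sub>F k in sequentially. measure (M k) (A k) \<le> 1"
      using prob by (simp add: prob_space.prob_le_1)
    have "filterlim (\<lambda>k. real (n k)) at_top sequentially"
      by (rule filterlim_compose[OF filterlim_real_sequentially n_lim])
    then have "(\<lambda>k. 1 - 4 / real (n k)) \<longlonglongrightarrow> 1 - 0"
      by (intro tendsto_diff tendsto_const real_tendsto_divide_at_top[OF tendsto_const])
    then show "(\<lambda>k. 1 - 4 / real (n k)) \<longlonglongrightarrow> 1" by simp
  qed simp
  then show ?thesis
    using Cpos A(1) A(3)[unfolded bound_def] by blast
qed

end
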